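(* Among all configurations $P=\{p_1,\dots,p_5\}$ of $5$ distinct points on the unit sphere $S^2\subset\mathbb{R}^3$, the triangular bi-pyramid is the unique configuration (up to isometries of $S^2$) of minimal energy with respect to the Coulomb potential, i.e. the unique minimizer of $$\mathcal{E}(P)=\sum_{i>j}\frac{1}{\|p_i-p_j\|}.$$
   Context: $\|\cdot\|$ is the Euclidean norm on $\mathbb{R}^3$. The triangular bi-pyramid (TBP) is the configuration of $5$ points on $S^2$ in which two points are antipodal and the remaining three points form an equilateral triangle on the equator midway between the two antipodal points. It is well defined up to isometries of $S^2$. *)

theory Defs
  imports "HOL-Analysis.Analysis"
begin

abbreviation S2 :: "(real^3) set" where
  "S2 \<equiv> sphere 0 1"

text \<open>A configuration is given by a labelling of its points by 1 to 5; values of p at other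
  indices are irrelevant, and the underlying point set is the image of {1..5}.\<close>

definition configuration :: "(nat \<Rightarrow> real^3) \<Rightarrow> bool" where
  "configuration p \<longleftrightarrow> p ` {1..5} \<subseteq> S2 \<and> inj_on p {1..5}"

definition coulomb_energy :: "(nat \<Rightarrow> real^3) \<Rightarrow> real" where
  "coulomb_energy p = (\<Sum>(i, j)\<in>{(i, j). i \<in> {1..5} \<and> j \<in> {1..5} \<and> i > j}. 1 / norm (p i - p j))"

definition minimal_energy :: "(nat \<Rightarrow> real^3) \<Rightarrow> bool" where
  "minimal_energy p \<longleftrightarrow>
     configuration p \<and> (\<forall>q. configuration q \<longrightarrow> coulomb_energy p \<le> coulomb_energy q)"

text \<open>Here n and -n are the antipodal points, and the equator midway between them is the great
  circle orthogonal to n.\<close>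

definition triangular_bipyramid :: "(real^3) set \<Rightarrow> bool" where
  "triangular_bipyramid T \<longleftrightarrow>
     (\<exists>n a b c. n \<in> S2 \<and> {a, b, c} \<subseteq> {x \<in> S2. x \<bullet> n = 0} \<and>
        a \<noteq> b \<and> dist a b = dist b c \<and> dist b c = dist c a \<and>
        T = {n, - n, a, b, c})"

text \<open>The metric is the chordal one. Spherical distance is a strictly monotone function of it, so
  both metrics have the same isometries.\<close>

definition sphere_isometry :: "(real^3 \<Rightarrow> real^3) \<Rightarrow> bool" where
  "sphere_isometry f \<longleftrightarrow> f ` S2 = S2 \<and> (\<forall>x\<in>S2. \<forall>y\<in>S2. dist (f x) (f y) = dist x y)"

end

theory Submission
  imports Defs
begin

text \<open>
  Let \<open>w = 1 + x \<bullet> y\<close> for unit vectors \<open>x\<close>, \<open>y\<close>, so that their Coulomb potential is \<open>1 / sqrt (4 - 2 * w)\<close>. It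
  is bounded from below by its quartic Hermite interpolant at the values 0, 1/2, 1 that \<open>w\<close> takes on
  the bi-pyramid, with equality only there. This interpolant is a constant plus a combination, with
  positive irrational coefficients, of \<open>w\<close>, \<open>w\<^sup>3\<close>, \<open>2 w\<^sup>2 + w\<^sup>3\<close> and \<open>24 w + 15 w\<^sup>2 - 9 w\<^sup>3 + 10 w\<^sup>4\<close>. The sum of each of
  these four potentials over the pairs is minimal at the bi-pyramid: for \<open>w\<close> because the squared norm of
  the sum of the points is nonnegative, and for the others by a sum of squares of degree four in the
  entries of the Gram matrix. Dimension three enters through squared norms of cross products and
  through the Cayley-Hamilton identity for the \<open>3 \<times> 3\<close> frame operator. In a configuration of minimal
  energy all \<open>w\<close> are thus 0, 1/2 or 1, and the equality of the sums of \<open>w\<close> and \<open>w\<^sup>3\<close> leaves only the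
  bi-pyramid.
\<close>

section \<open>Horner normal form for polynomial identities\<close>

text \<open>
  Polynomials in the variables \<open>X i\<close> are brought into Horner form with integer coefficients, the variable
  of least index outermost, by the rewrite rules \<open>normalize\<close> alone.
\<close>

definition const :: "int \<Rightarrow> real" where
  "const k = of_int k"

definition horner :: "(nat \<Rightarrow> real) \<Rightarrow> nat \<Rightarrow> real \<Rightarrow> real \<Rightarrow> real" where
  "horner X i p q = p * X i + q"

lemma var_eq: "X i = horner X i (const 1) (const 0)"
  by (simp add: horner_def const_def)

lemma const_simps:
  "const k + const l = const (k + l)" "const k * const l = const (k * l)"
  "const 0 + x = x" "const 0 * x = const 0" "const 1 * x = x"
  by (simp_all add: const_def)

lemma horner_simps:
  "horner X i (const 0) q = q"
  "const k + horner X i p q = horner X i p (const k + q)"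
  "horner X i p q + const k = horner X i p (q + const k)"
  "const k * horner X i p q = horner X i (const k * p) (const k * q)"
  "horner X i p q * const k = horner X i (const k * p) (const k * q)"
  "horner X i p q + horner X i p' q' = horner X i (p + p') (q + q')"
  "horner X i p q * horner X i p' q' =
    horner X i (horner X i (p * p') (const 0) + (p * q' + q * p')) (q * q')"
  by (simp_all add: horner_def const_def algebra_simps)

lemma horner_less:
  "i < j \<Longrightarrow> horner X i p q + horner X j p' q' = horner X i p (q + horner X j p' q')"
  "j < i \<Longrightarrow> horner X i p q + horner X j p' q' = horner X j p' (horner X i p q + q')"
  "i < j \<Longrightarrow> horner X i p q * horner X j p' q' = horner X i (p * horner X j p' q') (q * horner X j p' q')"
  "j < i \<Longrightarrow> horner X i p q * horner X j p' q' = horner X j (horner X i p q * p') (horner X i p q * q')"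
  by (simp_all add: horner_def algebra_simps)

lemma to_const:
  "(numeral n :: real) = const (numeral n)" "(1 :: real) = const 1" "(0 :: real) = const 0"
  "- x = const (- 1) * x" "x - y = x + const (- 1) * (y :: real)"
  by (simp_all add: const_def)

text \<open>Under \<open>simp only\<close>, coefficient arithmetic and index comparisons have to be
  evaluated by explicit rules on binary numerals.\<close>

lemmas num_simps = add_num_simps mult_num_simps sub_num_simps less_num_simps le_num_simps
  BitM.simps dbl_simps dbl_inc_simps dbl_dec_simps

lemmas int_simps = num_simps numeral_plus_numeral[where 'a=int] add_neg_numeral_simps[where 'a=int]
  diff_numeral_simps[where 'a=int] numeral_times_numeral[where 'a=int] mult_neg_numeral_simps[where 'a=int]
  add_numeral_special[where 'a=int] add_neg_numeral_special[where 'a=int] diff_numeral_special[where 'a=int]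
  add_0_left[where 'a=int] add_0_right[where 'a=int] mult_zero_left[where 'a=int] mult_zero_right[where 'a=int]
  mult_1_left[where 'a=int] mult_1_right[where 'a=int] mult_minus1[where 'a=int] mult_minus1_right[where 'a=int]
  minus_minus[where 'a=int] minus_zero[where 'a=int]

lemmas normalize = const_simps horner_simps horner_less to_const power2_eq_square power3_eq_cube power4_eq_xxxx
  int_simps less_numeral_simps[where 'a=nat]

text \<open>With both sides in one polynomial, all coefficients cancel and the normal form is
  \<open>const 0\<close>.\<close>

lemma diff_zero_imp_eq: "x - y = (0 :: real) \<Longrightarrow> x = y"
  by simp

text \<open>Clears denominators: the certificates below are integer identities for a positive
  multiple of the quantity in question.\<close>

lemma nonneg_if_multiple: "k * x = y \<Longrightarrow> 0 \<le> y \<Longrightarrow> 0 < k \<Longrightarrow> 0 \<le> (x :: real)"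
  by (auto simp: zero_le_mult_iff)

section \<open>A quadratic form on edge weights\<close>

text \<open>
  For symmetric \<open>f\<close>, \<open>g\<close> with zero diagonal, that is, weights on the edges of the complete graph on
  \<open>{1..5}\<close>, this is 24 times the inner product of their components of type \<open>(3, 2)\<close> under the symmetric group. It kills all weights of the
  form \<open>x i + x j\<close>.
\<close>

definition edge_form :: "(nat \<Rightarrow> nat \<Rightarrow> real) \<Rightarrow> (nat \<Rightarrow> nat \<Rightarrow> real) \<Rightarrow> real" where
  "edge_form f g = 12 * (\<Sum>i\<in>{1..5}. \<Sum>j\<in>{1..5}. f i j * g i j)
     - 8 * (\<Sum>i\<in>{1..5}. (\<Sum>j\<in>{1..5}. f i j) * (\<Sum>j\<in>{1..5}. g i j))
     + (\<Sum>i\<in>{1..5}. \<Sum>j\<in>{1..5}. f i j) * (\<Sum>i\<in>{1..5}. \<Sum>j\<in>{1..5}. g i j)"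

lemma sum_5: "(\<Sum>i\<in>{1..5::nat}. f i) = f 1 + f 2 + f 3 + f 4 + (f 5 :: real)"
proof -
  have "{1..5::nat} = {1, 2, 3, 4, 5}" by auto
  then show ?thesis by simp
qed

text \<open>The form is a multiple of the squared norm of a projection. Concretely it is a sum of
  squares of alternating sums round 4-cycles, which vanish on weights
  \<open>x i + x j\<close>.\<close>

lemma edge_form_nonneg:
  assumes sym: "\<And>i j. h i j = h j i" and diag: "\<And>i. h i i = 0"
  shows "0 \<le> edge_form h h"
proof -
  obtain y12 y13 y14 y15 y23 y24 y25 y34 y35 y45 where
    y: "h 1 2 = y12" "h 1 3 = y13" "h 1 4 = y14" "h 1 5 = y15" "h 2 3 = y23"
       "h 2 4 = y24" "h 2 5 = y25" "h 3 4 = y34" "h 3 5 = y35" "h 4 5 = y45"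
    by blast
  have y': "h 2 1 = y12" "h 3 1 = y13" "h 4 1 = y14" "h 5 1 = y15" "h 3 2 = y23"
       "h 4 2 = y24" "h 5 2 = y25" "h 4 3 = y34" "h 5 3 = y35" "h 5 4 = y45"
    using y sym by metis+
  \<comment> \<open>The sum is over the fifteen 4-cycles.\<close>
  have "edge_form h h = 2 * ((y12 + y34 - y13 - y24)\<^sup>2 + (y12 + y34 - y14 - y23)\<^sup>2 + (y12
        + y35 - y13 - y25)\<^sup>2 + (y12 + y35 - y15 - y23)\<^sup>2 + (y12 + y45 - y14
        - y25)\<^sup>2 + (y12 + y45 - y15 - y24)\<^sup>2 + (y13 + y24 - y14 - y23)\<^sup>2 + (y13
        + y25 - y15 - y23)\<^sup>2 + (y13 + y45 - y14 - y35)\<^sup>2 + (y13 + y45 - y15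
        - y34)\<^sup>2 + (y14 + y25 - y15 - y24)\<^sup>2 + (y14 + y35 - y15 - y34)\<^sup>2 + (y23
        + y45 - y24 - y35)\<^sup>2 + (y23 + y45 - y25 - y34)\<^sup>2 + (y24 + y35 - y25 - y34)\<^sup>2)"
    unfolding edge_form_def sum_5 y y' diag power2_eq_square by (simp add: algebra_simps)
  then show ?thesis by simp
qed

lemma edge_form_add_left: "edge_form (\<lambda>i j. f i j + g i j) h = edge_form f h + edge_form g h"
  by (simp add: edge_form_def sum.distrib algebra_simps)

lemma edge_form_add_right: "edge_form h (\<lambda>i j. f i j + g i j) = edge_form h f + edge_form h g"
  by (simp add: edge_form_def sum.distrib algebra_simps)

lemma edge_form_scale_left: "edge_form (\<lambda>i j. k * f i j) h = k * edge_form f h"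
  by (simp add: edge_form_def algebra_simps flip: sum_distrib_left)

lemma edge_form_scale_right: "edge_form h (\<lambda>i j. k * f i j) = k * edge_form h f"
  by (simp add: edge_form_def algebra_simps flip: sum_distrib_left)

lemma edge_form_commute: "edge_form f g = edge_form g f"
  by (simp add: edge_form_def mult.commute)

text \<open>Loops are not edges, and \<open>edge_form_nonneg\<close> requires a zero
  diagonal.\<close>

definition off_diagonal :: "(nat \<Rightarrow> nat \<Rightarrow> real) \<Rightarrow> nat \<Rightarrow> nat \<Rightarrow> real" where
  "off_diagonal f i j = (if i = j then 0 else f i j)"

lemma off_diagonal_simps:
  "off_diagonal f 1 1 = 0" "off_diagonal f 1 2 = f 1 2" "off_diagonal f 1 3 = f 1 3" "off_diagonal f 1 4 = f 1 4" "off_diagonal f 1 5 = f 1 5"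
  "off_diagonal f 2 1 = f 2 1" "off_diagonal f 2 2 = 0" "off_diagonal f 2 3 = f 2 3" "off_diagonal f 2 4 = f 2 4" "off_diagonal f 2 5 = f 2 5"
  "off_diagonal f 3 1 = f 3 1" "off_diagonal f 3 2 = f 3 2" "off_diagonal f 3 3 = 0" "off_diagonal f 3 4 = f 3 4" "off_diagonal f 3 5 = f 3 5"
  "off_diagonal f 4 1 = f 4 1" "off_diagonal f 4 2 = f 4 2" "off_diagonal f 4 3 = f 4 3" "off_diagonal f 4 4 = 0" "off_diagonal f 4 5 = f 4 5"
  "off_diagonal f 5 1 = f 5 1" "off_diagonal f 5 2 = f 5 2" "off_diagonal f 5 3 = f 5 3" "off_diagonal f 5 4 = f 5 4" "off_diagonal f 5 5 = 0"
  by (simp_all add: off_diagonal_def)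

section \<open>Symmetric invariants of a Gram matrix and their relations\<close>

text \<open>
  For a Gram matrix \<open>u i j = p i \<bullet> p j\<close>, with \<open>V\<close> the sum of the \<open>p i\<close> and \<open>M\<close> the sum of the projections
  \<open>x \<mapsto> (p i \<bullet> x) p i\<close>, the quantities below are \<open>r i = p i \<bullet> V\<close>, \<open>m i = p i \<bullet> M (p i)\<close>, \<open>y i = p i \<bullet> M V\<close>,
  \<open>q i j = p i \<bullet> M (p j)\<close>, \<open>n i = p i \<bullet> M (M (p i))\<close>, \<open>a = V \<bullet> V\<close>, \<open>c = V \<bullet> M V\<close>, \<open>c2 = V \<bullet> M (M V)\<close>,
  \<open>v3 = V \<bullet> M (M (M V))\<close>; and \<open>b\<close>, \<open>t3\<close>, \<open>t4\<close> are the traces of the powers of \<open>M\<close>. The entries are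
  numbered from 2 because the rules \<open>normalize\<close> compare indices as binary numerals.
\<close>

locale gram_matrix_5 =
  fixes u :: "nat \<Rightarrow> nat \<Rightarrow> real" and X :: "nat \<Rightarrow> real"
  assumes entries: "u 1 1 = 1" "u 1 2 = X 2" "u 1 3 = X 3" "u 1 4 = X 4" "u 1 5 = X 5"
    "u 2 1 = X 2" "u 2 2 = 1" "u 2 3 = X 6" "u 2 4 = X 7" "u 2 5 = X 8"
    "u 3 1 = X 3" "u 3 2 = X 6" "u 3 3 = 1" "u 3 4 = X 9" "u 3 5 = X 10"
    "u 4 1 = X 4" "u 4 2 = X 7" "u 4 3 = X 9" "u 4 4 = 1" "u 4 5 = X 11"
    "u 5 1 = X 5" "u 5 2 = X 8" "u 5 3 = X 10" "u 5 4 = X 11" "u 5 5 = 1"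
begin

definition r where "r i = (\<Sum>j\<in>{1..5}. u i j)"
definition m where "m i = (\<Sum>j\<in>{1..5}. (u i j)\<^sup>2)"
definition y where "y i = (\<Sum>j\<in>{1..5}. u i j * r j)"
definition q where "q i j = (\<Sum>k\<in>{1..5}. u i k * u k j)"
definition n where "n i = (\<Sum>j\<in>{1..5}. u i j * q i j)"

definition "a = (\<Sum>i\<in>{1..5}. r i)"
definition "b = (\<Sum>i\<in>{1..5}. m i)"
definition "c = (\<Sum>i\<in>{1..5}. (r i)\<^sup>2)"
definition "c2 = (\<Sum>i\<in>{1..5}. r i * y i)"
definition "d1 = (\<Sum>i\<in>{1..5}. m i * r i)"
definition "e3 = (\<Sum>i\<in>{1..5}. \<Sum>j\<in>{1..5}. (u i j)^3)"
definition "e4 = (\<Sum>i\<in>{1..5}. \<Sum>j\<in>{1..5}. (u i j)^4)"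
definition "s3 = (\<Sum>i\<in>{1..5}. (r i)^3)"
definition "s4 = (\<Sum>i\<in>{1..5}. (r i)^4)"
definition "t3 = (\<Sum>i\<in>{1..5}. n i)"
definition "t4 = (\<Sum>i\<in>{1..5}. \<Sum>j\<in>{1..5}. (q i j)\<^sup>2)"
definition "v3 = (\<Sum>i\<in>{1..5}. (y i)\<^sup>2)"
definition "mm = (\<Sum>i\<in>{1..5}. (m i)\<^sup>2)"
definition "my = (\<Sum>i\<in>{1..5}. m i * y i)"
definition "rn = (\<Sum>i\<in>{1..5}. r i * n i)"
definition "mr2 = (\<Sum>i\<in>{1..5}. m i * (r i)\<^sup>2)"
definition "r2y = (\<Sum>i\<in>{1..5}. (r i)\<^sup>2 * y i)"

lemmas defs = r_def m_def y_def q_def n_def a_def b_def c_def c2_def d1_def e3_def e4_def s3_def s4_def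
  t3_def t4_def v3_def mm_def my_def rn_def mr2_def r2y_def

text \<open>The ten off-diagonal entries are replaced by Horner variables in \<open>entries\<close>
  itself. Only instances of \<open>var_eq\<close> are used, since its general left side would match
  any application.\<close>

lemmas expand = defs sum_5 entries[unfolded var_eq[of X 2] var_eq[of X 3] var_eq[of X 4]
  var_eq[of X 5] var_eq[of X 6] var_eq[of X 7] var_eq[of X 8] var_eq[of X 9] var_eq[of X 10] var_eq[of X 11]]

text \<open>
  These relations express that six indices in \<open>{1..5}\<close> cannot be distinct.
\<close>

lemma rel_aaa: "(a * a * a) = 275 - 33 * a - 42 * b + 60 * c - 16 * e3 + 8 * t3 + 48 * d1 - 16 * s3
      - 24 * c2 - 9 * (a * a) - 6 * (a * b) + 12 * (a * c)"
  unfolding expand by (rule diff_zero_imp_eq, simp only: normalize)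

lemma rel_aac: "8 * (a * a * c) = 3125 - 302 * a - 259 * b + 248 * c - 256 * e3 - 8 * e4 - 36 * t3
      - 24 * d1 + 8 * s3 + 132 * c2 - 148 * mm + 184 * mr2 + 208 * my + 96 * rn - 20 * s4 - 112 * r2y
      - 128 * v3 + 32 * t4 - 33 * (a * a) + 26 * (a * b) - 28 * (a * c) + 22 * (b * b) - 60 * (b * c)
      + 36 * (c * c) - 12 * (a * t3) - 56 * (a * d1) + 8 * (a * s3) + 44 * (a * c2) + 9 * (a * a * b)"
  unfolding expand by (rule diff_zero_imp_eq, simp only: normalize)

lemma rel_aaaa: "(a * a * a * a) = 3550 - 282 * a - 201 * b + 64 * c - 320 * e3 - 24 * e4 - 92 * t3
      - 296 * d1 + 56 * s3 + 316 * c2 - 204 * mm + 264 * mr2 + 304 * my + 160 * rn - 12 * s4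
      - 144 * r2y - 192 * v3 + 48 * t4 - 5 * (a * a) + 70 * (a * b) - 68 * (a * c) + 30 * (b * b)
      - 84 * (b * c) + 44 * (c * c) - 20 * (a * t3) - 72 * (a * d1) - 8 * (a * s3) + 52 * (a * c2)
      + 11 * (a * a * b)"
  unfolding expand by (rule diff_zero_imp_eq, simp only: normalize)

text \<open>
  At the bi-pyramid each of these weights has the form \<open>x i + x j\<close>, so that its form \<open>edge_form\<close> vanishes; this
  determines the coefficients 5/6 and 11/6.
\<close>

definition g1 where "g1 = off_diagonal (\<lambda>i j. 6 * (u i j)\<^sup>2 + 5 * u i j)"
definition g2 where "g2 = off_diagonal (\<lambda>i j. 6 * q i j - 11 * u i j)"
definition g3 where "g3 = off_diagonal (\<lambda>i j. r i * r j)"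
definition g4 where "g4 = off_diagonal (\<lambda>i j. u i j * (r i + r j))"

text \<open>
  With \<open>{k, l, m'}\<close> the complement of \<open>{i, j}\<close>, these span the quadratic polynomials in \<open>u\<close> that are alternating
  both in \<open>i, j\<close> and in \<open>k, l, m'\<close>.
\<close>

definition z0 where "z0 i j k l m' = (u i k * u j l - u i l * u j k) + (u i l * u j m' - u i m' * u j l)
  + (u i m' * u j k - u i k * u j m')"
definition z1 where "z1 i j k l m' = (u i k - u j k) * (u k l - u k m') + (u i l - u j l) * (u l m'
      - u l k)
  + (u i m' - u j m') * (u m' k - u m' l)"
definition pairs :: "(nat \<Rightarrow> nat \<Rightarrow> nat \<Rightarrow> nat \<Rightarrow> nat \<Rightarrow> real) \<Rightarrow> real" where
  "pairs f = f 1 2 3 4 5 + f 1 3 2 4 5 + f 1 4 2 3 5 + f 1 5 2 3 4 + f 2 3 1 4 5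
    + f 2 4 1 3 5 + f 2 5 1 3 4 + f 3 4 1 2 5 + f 3 5 1 2 4 + f 4 5 1 2 3"

text \<open>This and the next nine lemmas are the table of inner products of \<open>g1\<close> to
  \<open>g4\<close> in terms of the invariants. The factors on the left clear denominators.\<close>

lemma g11: "edge_form g1 g1 = - 9075 + 330 * a + 696 * b - 200 * c + 720 * e3 + 432 * e4 - 480 * d1
      - 288 * mm + 25 * (a * a) + 60 * (a * b) + 36 * (b * b)"
  unfolding edge_form_def g1_def g1_def sum_5 off_diagonal_simps
  unfolding expand
    by (rule diff_zero_imp_eq, simp only: normalize)

lemma g12: "8 * edge_form g1 g2 = - 11775 + 3930 * a + 4089 * b - 3968 * c + 576 * e3 + 216 * e4
      - 2196 * t3 - 8760 * d1 - 216 * s3 + 3156 * c2 + 1116 * mm + 216 * mr2 - 1008 * my + 4320 * rn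
      + 540 * s4 - 432 * r2y - 1728 * v3 + 864 * t4 + 451 * (a * a) + 690 * (a * b) - 300 * (a * c)
      - 450 * (b * b) + 612 * (b * c) - 108 * (c * c) - 540 * (a * t3) - 216 * (a * d1)
      - 216 * (a * s3) + 540 * (a * c2) - 27 * (a * a * b)"
  unfolding edge_form_def g1_def g2_def sum_5 off_diagonal_simps
  unfolding expand
    by (rule diff_zero_imp_eq, simp only: normalize)

lemma g13: "16 * edge_form g1 g3 = 13225 - 3414 * a - 1047 * b + 4608 * c - 1280 * e3 + 792 * e4
      - 404 * t3 + 1608 * d1 - 2008 * s3 + 84 * c2 - 2628 * mm + 1560 * mr2 + 2448 * my - 288 * rn
      + 252 * s4 + 720 * r2y - 576 * v3 + 288 * t4 - 597 * (a * a) + 114 * (a * b) + 276 * (a * c)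
      + 414 * (b * b) - 924 * (b * c) + 180 * (c * c) + 36 * (a * t3) - 984 * (a * d1)
      - 216 * (a * s3) - 36 * (a * c2) + 213 * (a * a * b)"
  unfolding edge_form_def g1_def g3_def sum_5 off_diagonal_simps
  unfolding expand
    by (rule diff_zero_imp_eq, simp only: normalize)

lemma g14: "2 * edge_form g1 g4 = - 4275 + 222 * a + 405 * b - 68 * c + 288 * e3 + 216 * e4 - 36 * t3
      - 144 * d1 + 64 * s3 + 100 * c2 - 324 * mm + 120 * mr2 + 192 * my - 144 * rn - 36 * s4
      - 29 * (a * a) - 6 * (a * b) - 16 * (a * c) + 54 * (b * b) - 84 * (b * c) + 36 * (c * c)
      + 36 * (a * t3) - 36 * (a * c2) + 9 * (a * a * b)"
  unfolding edge_form_def g1_def g4_def sum_5 off_diagonal_simps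
  unfolding expand
    by (rule diff_zero_imp_eq, simp only: normalize)

lemma g22: "edge_form g2 g2 = - 9075 + 726 * a + 3432 * b - 1364 * c - 1584 * t3 - 1056 * d1
      + 1056 * c2 - 720 * mm + 576 * my - 288 * v3 + 432 * t4 + 121 * (a * a) + 132 * (a * b)
      - 132 * (a * c) + 36 * (b * b) - 72 * (b * c) + 36 * (c * c)"
  unfolding edge_form_def g2_def g2_def sum_5 off_diagonal_simps
  unfolding expand
    by (rule diff_zero_imp_eq, simp only: normalize)

lemma g23: "4 * edge_form g2 g3 = - 2725 + 546 * a + 1071 * b - 1236 * c - 64 * e3 - 24 * e4
      - 460 * t3 - 2184 * d1 + 376 * s3 + 924 * c2 - 444 * mm + 72 * mr2 + 624 * my + 288 * rn
      - 60 * s4 - 144 * r2y - 96 * v3 + 96 * t4 + 165 * (a * a) + 342 * (a * b) - 216 * (a * c)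
      + 66 * (b * b) - 156 * (b * c) + 84 * (c * c) - 36 * (a * t3) + 24 * (a * d1) + 24 * (a * s3)
      - 60 * (a * c2) + 3 * (a * a * b)"
  unfolding edge_form_def g2_def g3_def sum_5 off_diagonal_simps
  unfolding expand
    by (rule diff_zero_imp_eq, simp only: normalize)

lemma g24: "edge_form g2 g4 = 330 * a - 242 * c - 504 * d1 + 88 * s3 + 184 * c2 + 48 * mr2 + 48 * my
      + 144 * rn - 48 * r2y - 48 * v3 + 22 * (a * a) + 12 * (a * b) - 34 * (a * c) - 12 * (b * c)
      + 12 * (c * c)"
  unfolding edge_form_def g2_def g4_def sum_5 off_diagonal_simps
  unfolding expand
    by (rule diff_zero_imp_eq, simp only: normalize)

lemma g33: "4 * edge_form g3 g3 = - 1425 + 382 * a + 491 * b - 984 * c - 56 * e4 - 188 * t3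
      - 1064 * d1 + 184 * s3 + 604 * c2 - 76 * mm + 136 * mr2 + 176 * my + 160 * rn - 28 * s4
      - 16 * r2y - 128 * v3 + 32 * t4 + 145 * (a * a) + 150 * (a * b) - 132 * (a * c) + 10 * (b * b)
      - 36 * (b * c) + 48 * (c * c) - 20 * (a * t3) - 8 * (a * d1) - 8 * (a * s3) - 12 * (a * c2)
      - a * a * b"
  unfolding edge_form_def g3_def g3_def sum_5 off_diagonal_simps
  unfolding expand
    by (rule diff_zero_imp_eq, simp only: normalize)

lemma g34: "4 * edge_form g3 g4 = 925 - 38 * a + 77 * b - 232 * c - 128 * e3 - 8 * e4 - 100 * t3
      - 408 * d1 - 24 * s3 + 324 * c2 - 148 * mm + 184 * mr2 + 208 * my + 96 * rn + 12 * s4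
      + 16 * r2y - 128 * v3 + 32 * t4 + 39 * (a * a) + 74 * (a * b) - 52 * (a * c) + 22 * (b * b)
      - 60 * (b * c) + 28 * (c * c) - 12 * (a * t3) - 56 * (a * d1) - 24 * (a * s3) + 12 * (a * c2)
      + 9 * (a * a * b)"
  unfolding edge_form_def g3_def g4_def sum_5 off_diagonal_simps
  unfolding expand
    by (rule diff_zero_imp_eq, simp only: normalize)

lemma g44: "16 * edge_form g4 g4 = - 2925 - 258 * a + 771 * b - 464 * c + 264 * e4 - 348 * t3
      - 744 * d1 + 56 * s3 + 860 * c2 - 876 * mm + 648 * mr2 + 816 * my - 96 * rn - 44 * s4
      - 16 * r2y - 320 * v3 + 96 * t4 - 71 * (a * a) + 198 * (a * b) - 116 * (a * c) + 138 * (b * b)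
      - 276 * (b * c) + 124 * (c * c) + 12 * (a * t3) - 72 * (a * d1) - 72 * (a * s3) - 12 * (a * c2)
      + 39 * (a * a * b)"
  unfolding edge_form_def g4_def g4_def sum_5 off_diagonal_simps
  unfolding expand
    by (rule diff_zero_imp_eq, simp only: normalize)

text \<open>Products of two alternating polynomials do not depend on the order within a pair or its
  complement. Their sum over the ten pairs is therefore symmetric and expressible in the
  invariants.\<close>

lemma z00: "128 * pairs (\<lambda>i j k l m'. z0 i j k l m' * z0 i j k l m') = 8675 - 1762 * a
      - 2861 * b + 1008 * c + 136 * e4 + 868 * t3 - 40 * d1 - 136 * s3 - 484 * c2 - 268 * mm
      - 56 * mr2 + 48 * my + 32 * rn + 52 * s4 - 16 * r2y + 64 * v3 - 160 * t4 + 41 * (a * a)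
      + 294 * (a * b) + 12 * (a * c) + 138 * (b * b) - 20 * (b * c) - 36 * (c * c) - 52 * (a * t3)
      - 8 * (a * d1) - 8 * (a * s3) + 52 * (a * c2) - 9 * (a * a * b)"
  unfolding pairs_def z0_def z1_def expand by (rule diff_zero_imp_eq, simp only: normalize)

lemma z01: "64 * pairs (\<lambda>i j k l m'. z0 i j k l m' * z1 i j k l m') = - 8075 + 1138 * a
      + 2549 * b - 1760 * c + 56 * e4 - 772 * t3 - 552 * d1 + 24 * s3 + 804 * c2 - 20 * mm
      - 136 * mr2 - 16 * my + 192 * rn + 44 * s4 - 80 * r2y - 256 * v3 + 160 * t4 + 191 * (a * a)
      - 70 * (a * b) - 92 * (a * c) - 90 * (b * b) + 180 * (b * c) - 28 * (c * c) - 12 * (a * t3)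
      + 56 * (a * d1) - 8 * (a * s3) + 76 * (a * c2) - 31 * (a * a * b)"
  unfolding pairs_def z0_def z1_def expand by (rule diff_zero_imp_eq, simp only: normalize)

lemma z11: "128 * pairs (\<lambda>i j k l m'. z1 i j k l m' * z1 i j k l m') = 25025 - 2486 * a
      - 7663 * b + 5008 * c - 552 * e4 + 2124 * t3 + 3336 * d1 - 408 * s3 - 1356 * c2 - 228 * mm
      - 168 * mr2 + 1296 * my - 1824 * rn - 36 * s4 + 336 * r2y + 576 * v3 - 480 * t4 - 637 * (a * a)
      - 286 * (a * b) + 196 * (a * c) + 398 * (b * b) - 796 * (b * c) + 212 * (c * c)
      + 324 * (a * t3) - 24 * (a * d1) - 24 * (a * s3) - 324 * (a * c2) + 93 * (a * a * b)"
  unfolding pairs_def z0_def z1_def expand by (rule diff_zero_imp_eq, simp only: normalize)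

text \<open>For a Gram matrix this is the inner product of \<open>p i\<close> with
  \<open>M (M V)\<close>.\<close>

definition z where "z i = (\<Sum>j\<in>{1..5}. u i j * y j)"

lemma sum_y: "(\<Sum>i\<in>{1..5}. y i) = c"
  unfolding expand by (rule diff_zero_imp_eq, simp only: normalize)

lemma sum_z: "(\<Sum>i\<in>{1..5}. z i) = c2"
  unfolding z_def expand by (rule diff_zero_imp_eq, simp only: normalize)

lemma sum_z_r: "(\<Sum>i\<in>{1..5}. z i * r i) = v3"
  unfolding z_def expand by (rule diff_zero_imp_eq, simp only: normalize)

end

section \<open>Inequalities and identities special to dimension three\<close>

locale five_points =
  fixes p :: "nat \<Rightarrow> real^3"
  assumes unit: "i \<in> {1..5} \<Longrightarrow> p i \<bullet> p i = 1"
begin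

definition u where "u i j = p i \<bullet> p j"

text \<open>The two leading zeros shift the ten entries to the indices from 2 on.\<close>

sublocale gram_matrix_5 u "\<lambda>k. [0, 0, u 1 2, u 1 3, u 1 4, u 1 5, u 2 3, u 2 4, u 2 5, u 3 4, u 3 5, u 4 5] ! k"
  using unit by unfold_locales (simp_all add: u_def inner_commute)

definition "V = (\<Sum>i\<in>{1..5}. p i)"
definition "M x = (\<Sum>i\<in>{1..5}. (p i \<bullet> x) *\<^sub>R p i)"

lemma inner_V: "p i \<bullet> V = r i"
  by (simp add: V_def r_def u_def inner_sum_right)

lemma V_V: "V \<bullet> V = a"
  by (simp add: a_def flip: inner_V) (simp add: V_def inner_sum_left)

lemma inner_M: "x \<bullet> M w = (\<Sum>i\<in>{1..5}. (p i \<bullet> x) * (p i \<bullet> w))"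
  by (simp add: M_def inner_sum_right inner_commute mult.commute)

lemma M_sym: "M x \<bullet> w = x \<bullet> M w"
  by (simp add: inner_M inner_commute[of "M x"] mult.commute)

lemma p_Mp: "p i \<bullet> M (p j) = q i j"
  by (simp add: inner_M q_def u_def inner_commute)

lemma p_Mp': "p i \<bullet> M (p i) = m i"
  by (simp add: inner_M m_def u_def inner_commute power2_eq_square)

lemma p_MV: "p i \<bullet> M V = y i"
  by (simp add: inner_M y_def inner_V) (simp add: u_def inner_commute)

lemma V_MV: "V \<bullet> M V = c"
  by (simp add: inner_M inner_V c_def power2_eq_square)

lemma MV_MV: "M V \<bullet> M V = c2"
  by (simp add: inner_M[of "M V"] inner_V p_MV c2_def mult.commute)

lemma Mp_Mp: "M (p i) \<bullet> M (p i) = n i"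
  by (simp add: inner_M[of "M (p i)"] p_Mp n_def) (simp add: u_def q_def inner_commute mult.commute)

lemma Mp_MV: "M (p i) \<bullet> M V = z i"
proof -
  have "M (p i) \<bullet> M V = p i \<bullet> M (M V)"
    by (rule M_sym)
  also have "\<dots> = (\<Sum>j\<in>{1..5}. (p j \<bullet> p i) * (p j \<bullet> M V))"
    by (rule inner_M)
  also have "\<dots> = z i"
    by (simp only: p_MV z_def u_def inner_commute)
  finally show ?thesis .
qed

text \<open>
  The squared norm of a combination of the six vectors \<open>p \<times> V\<close>, \<open>p \<times> M p\<close>, \<open>r (p \<times> V)\<close>, \<open>M p \<times> V\<close>, \<open>a (p \<times> V)\<close>,
  \<open>p \<times> M V\<close>, all of which vanish at the bi-pyramid.
\<close>

lemma W_summand_identity: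
  fixes a c c2 r m y n z :: real
  shows "((k1 + k3 * r + k5 * a)\<^sup>2 * a + k2\<^sup>2 * n + k6\<^sup>2 * c2
      + 2 * ((k1 + k3 * r + k5 * a) * k2 * y + (k1 + k3 * r + k5 * a) * k6 * c + k2 * k6 * z)
      - ((k1 + k3 * r + k5 * a) * r + k2 * m + k6 * y)\<^sup>2)
    + 2 * k4 * (m * ((k1 + k3 * r + k5 * a) * a + k2 * y + k6 * c)
      - r * ((k1 + k3 * r + k5 * a) * y + k2 * n + k6 * z)) + k4\<^sup>2 * (n * a - y\<^sup>2)
    = k1\<^sup>2 * (a - r\<^sup>2) + k2\<^sup>2 * (n - m\<^sup>2) + k3\<^sup>2 * (r\<^sup>2 * a - r ^ 4)
    + k4\<^sup>2 * (n * a - y\<^sup>2) + k5\<^sup>2 * (a * a * a - a * a * r\<^sup>2)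
          + k6\<^sup>2 * (c2 - y\<^sup>2)
    + 2 * (k1 * k2 * (y - m * r) + k1 * k3 * (r * a - r ^ 3) + k1 * k4 * (m * a - r * y)
    + k1 * k5 * (a * a - a * r\<^sup>2) + k1 * k6 * (c - r * y)
    + k2 * k3 * (r * y - m * r\<^sup>2) + k2 * k4 * (m * y - r * n) + k2 * k5 * (a * y - a * (m * r))
    + k2 * k6 * (z - m * y)
    + k3 * k4 * (a * (m * r) - r\<^sup>2 * y) + k3 * k5 * (a * a * r - a * r ^ 3) + k3 * k6 * (c * r
          - r\<^sup>2 * y)
    + k4 * k5 * (a * a * m - a * (r * y)) + k4 * k6 * (c * m - z * r) + k5 * k6 * (a * c - a * (r * y)))"
  by (simp add: algebra_simps power2_eq_square power3_eq_cube power4_eq_xxxx)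

text \<open>Expanded so that each monomial, summed over \<open>i\<close>, becomes one of the
  invariants.\<close>

definition "W_summand k1 k2 k3 k4 k5 k6 i = k1\<^sup>2 * (a - (r i)\<^sup>2) + k2\<^sup>2 * (n i
      - (m i)\<^sup>2) + k3\<^sup>2 * ((r i)\<^sup>2 * a - (r i) ^ 4)
    + k4\<^sup>2 * (n i * a - (y i)\<^sup>2) + k5\<^sup>2 * (a * a * a - a * a * (r i)\<^sup>2)
          + k6\<^sup>2 * (c2 - (y i)\<^sup>2)
    + 2 * (k1 * k2 * (y i - m i * r i) + k1 * k3 * (r i * a - (r i) ^ 3) + k1 * k4 * (m i * a
          - r i * y i)
    + k1 * k5 * (a * a - a * (r i)\<^sup>2) + k1 * k6 * (c - r i * y i)
    + k2 * k3 * (r i * y i - m i * (r i)\<^sup>2) + k2 * k4 * (m i * y i - r i * n i)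
          + k2 * k5 * (a * y i - a * (m i * r i))
    + k2 * k6 * (z i - m i * y i)
    + k3 * k4 * (a * (m i * r i) - (r i)\<^sup>2 * y i) + k3 * k5 * (a * a * r i - a * (r i) ^ 3)
          + k3 * k6 * (c * r i - (r i)\<^sup>2 * y i)
    + k4 * k5 * (a * a * m i - a * (r i * y i)) + k4 * k6 * (c * m i - z i * r i) + k5 * k6 * (a * c
          - a * (r i * y i)))"

text \<open>This is the squared length of the vector \<open>X\<close> below.\<close>

lemma W_summand_nonneg:
  assumes "i \<in> {1..5}"
  shows "0 \<le> W_summand k1 k2 k3 k4 k5 k6 i"
proof -
  \<comment> \<open>Five of the six vectors are cross products with \<open>p i\<close> on the left,
    up to scalars; they combine into \<open>p i\<close> crossed with \<open>A\<close>.\<close>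
  define A where "A = (k1 + k3 * r i + k5 * a) *\<^sub>R V + k2 *\<^sub>R M (p i) + k6 *\<^sub>R M V"
  define X where "X = cross3 (p i) A + k4 *\<^sub>R cross3 (M (p i)) V"
  have Mp_V: "M (p i) \<bullet> V = y i"
    by (simp add: M_sym p_MV)
  note ips = unit[OF assms] V_V inner_V p_MV V_MV MV_MV Mp_Mp Mp_MV Mp_V p_Mp'
    inner_commute[of V "p i"] inner_commute[of V "M (p i)"] inner_commute[of "M V" "p i"]
    inner_commute[of "M V" "M (p i)"] inner_commute[of "M V" V] inner_commute[of "M (p i)" "p i"]
  define l where "l = k1 + k3 * r i + k5 * a"
  have AA: "A \<bullet> A = l\<^sup>2 * a + k2\<^sup>2 * n i + k6\<^sup>2 * c2 + 2 * (l * k2 * y i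
        + l * k6 * c + k2 * k6 * z i)"
    unfolding A_def l_def[symmetric]
      by (simp add: inner_add_left inner_add_right ips power2_eq_square algebra_simps)
  have pA: "p i \<bullet> A = l * r i + k2 * m i + k6 * y i"
    unfolding A_def l_def[symmetric] by (simp add: inner_add_left inner_add_right ips)
  have AV: "A \<bullet> V = l * a + k2 * y i + k6 * c"
    unfolding A_def l_def[symmetric] by (simp add: inner_add_left inner_add_right ips)
  have AM: "A \<bullet> M (p i) = l * y i + k2 * n i + k6 * z i"
    unfolding A_def l_def[symmetric] by (simp add: inner_add_left inner_add_right ips)
  have "0 \<le> X \<bullet> X"
    by simp
  \<comment> \<open>The Lagrange identity \<open>dot_cross\<close> turns products of cross products
    into inner products.\<close>
  also have "X \<bullet> X = (A \<bullet> A - (p i \<bullet> A)\<^sup>2)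
        + 2 * k4 * (m i * (A \<bullet> V) - r i * (A \<bullet> M (p i)))
      + k4\<^sup>2 * (n i * a - (y i)\<^sup>2)"
    unfolding X_def
    by (simp add: inner_add_left inner_add_right dot_cross ips inner_commute[of A "p i"] inner_commute[of V A]
      inner_commute[of "M (p i)" A] power2_eq_square algebra_simps)
  also have "\<dots> = W_summand k1 k2 k3 k4 k5 k6 i"
    unfolding AA pA AV AM l_def W_summand_def by (rule W_summand_identity)
  finally show ?thesis .
qed

text \<open>The sum of \<open>W_summand\<close> over the five points, written in the
  invariants.\<close>

definition "W_form k1 k2 k3 k4 k5 k6 = k1\<^sup>2 * (5 * a - c) + k2\<^sup>2 * (t3 - mm)
      + k3\<^sup>2 * (c * a - s4) + k4\<^sup>2 * (t3 * a - v3)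
    + k5\<^sup>2 * (a * a * (5 * a) - a * a * c) + k6\<^sup>2 * (5 * c2 - v3)
    + 2 * (k1 * k2 * (c - d1) + k1 * k3 * (a * a - s3) + k1 * k4 * (b * a - c2)
    + k1 * k5 * (a * (5 * a) - a * c) + k1 * k6 * (5 * c - c2)
    + k2 * k3 * (c2 - mr2) + k2 * k4 * (my - rn) + k2 * k5 * (a * c - a * d1) + k2 * k6 * (c2 - my)
    + k3 * k4 * (a * d1 - r2y) + k3 * k5 * (a * a * a - a * s3) + k3 * k6 * (c * a - r2y)
    + k4 * k5 * (a * a * b - a * c2) + k4 * k6 * (c * b - v3) + k5 * k6 * (a * (5 * c) - a * c2))"

lemma W_form_nonneg: "0 \<le> W_form k1 k2 k3 k4 k5 k6"
proof -
  have const: "(\<Sum>i\<in>{1..5::nat}. x) = 5 * x" for x :: real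
    by simp
  note folds = a_def[symmetric] b_def[symmetric] c_def[symmetric] c2_def[symmetric] d1_def[symmetric]
    s3_def[symmetric] s4_def[symmetric] t3_def[symmetric] v3_def[symmetric] mm_def[symmetric]
    my_def[symmetric] rn_def[symmetric] mr2_def[symmetric] r2y_def[symmetric] sum_y sum_z sum_z_r
  have "0 \<le> (\<Sum>i\<in>{1..5}. W_summand k1 k2 k3 k4 k5 k6 i)"
    by (intro sum_nonneg W_summand_nonneg)
  then show ?thesis
    unfolding W_form_def
    by (simp only: W_summand_def sum.distrib sum_subtractf sum_distrib_left[symmetric]
      sum_distrib_right[symmetric] const folds)
qed

text \<open>The matrix of the frame operator \<open>M\<close> in the standard basis.\<close>

definition A where "A s t = (\<Sum>i\<in>{1..5}. p i $ s * p i $ t)" for s t :: 3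

lemma M_component: "M x $ s = A s 1 * x $ 1 + A s 2 * x $ 2 + A s 3 * x $ 3"
  unfolding A_def sum_distrib_right sum.distrib[symmetric]
  by (simp add: M_def inner_vec_def sum_3 algebra_simps)

lemma A_sym: "A s t = A t s"
  by (simp add: A_def mult.commute)

text \<open>When \<open>f i\<close> is a fixed matrix \<open>B\<close> applied to
  \<open>p i\<close>, the sum is the trace of \<open>B\<close> times the frame operator.\<close>

lemma trace_form: "(\<Sum>i\<in>{1..5}. p i \<bullet> f i) = (\<Sum>s\<in>UNIV. \<Sum>t\<in>UNIV. B s t * A s t)"
  if "\<And>i s. f i $ s = (\<Sum>t\<in>UNIV. B s t * p i $ t)" for B :: "3 \<Rightarrow> 3 \<Rightarrow> real"
proof -
  have "(\<Sum>i\<in>{1..5}. p i \<bullet> f i) = (\<Sum>i\<in>{1..5}. \<Sum>s\<in>UNIV. \<Sum>t\<in>UNIV. B s t * (p i $ s * p i $ t))"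
    by (simp add: inner_vec_def that sum_distrib_left algebra_simps)
  also have "\<dots> = (\<Sum>s\<in>UNIV. \<Sum>i\<in>{1..5}. \<Sum>t\<in>UNIV. B s t * (p i $ s * p i $ t))"
    by (rule sum.swap)
  also have "\<dots> = (\<Sum>s\<in>UNIV. \<Sum>t\<in>UNIV. \<Sum>i\<in>{1..5}. B s t * (p i $ s * p i $ t))"
    by (rule sum.cong[OF refl]) (rule sum.swap)
  also have "\<dots> = (\<Sum>s\<in>UNIV. \<Sum>t\<in>UNIV. B s t * A s t)"
    by (simp only: A_def sum_distrib_left)
  finally show ?thesis .
qed

definition AA where "AA s t = A s 1 * A 1 t + A s 2 * A 2 t + A s 3 * A 3 t" for s t :: 3

text \<open>The traces of \<open>M\<close> and its powers, by \<open>trace_form\<close> with the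
  identity matrix, \<open>A\<close> and \<open>AA\<close> for \<open>B\<close>. The first is 5
  because the points are unit vectors.\<close>

lemma traces:
  "A 1 1 + A 2 2 + A 3 3 = 5"
  "b = (A 1 1)\<^sup>2 + (A 2 2)\<^sup>2 + (A 3 3)\<^sup>2 + 2 * ((A 1 2)\<^sup>2 + (A 1 3)\<^sup>2
        + (A 2 3)\<^sup>2)"
  "t3 = (\<Sum>s\<in>UNIV. \<Sum>t\<in>UNIV. AA s t * A s t)"
proof -
  have "(\<Sum>i\<in>{1..5}. p i \<bullet> p i) = (\<Sum>s\<in>UNIV. \<Sum>t\<in>UNIV. (if s = t then 1 else 0) * A s t)"
    by (rule trace_form) (simp add: if_distrib[of "\<lambda>x. x * _"] cong: if_cong)
  then show "A 1 1 + A 2 2 + A 3 3 = 5"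
    by (simp add: unit sum_3)
  have "(\<Sum>i\<in>{1..5}. p i \<bullet> M (p i)) = (\<Sum>s\<in>UNIV. \<Sum>t\<in>UNIV. A s t * A s t)"
    by (rule trace_form) (simp add: M_component sum_3)
  then show "b = (A 1 1)\<^sup>2 + (A 2 2)\<^sup>2 + (A 3 3)\<^sup>2 + 2 * ((A 1 2)\<^sup>2
        + (A 1 3)\<^sup>2 + (A 2 3)\<^sup>2)"
    unfolding p_Mp' b_def[symmetric]
    by (simp add: sum_3 power2_eq_square A_sym[of 2 1] A_sym[of 3 1] A_sym[of 3 2])
  have "t3 = (\<Sum>i\<in>{1..5}. p i \<bullet> M (M (p i)))"
    by (simp add: t3_def flip: Mp_Mp M_sym)
  also have "\<dots> = (\<Sum>s\<in>UNIV. \<Sum>t\<in>UNIV. AA s t * A s t)"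
    by (rule trace_form) (simp add: M_component AA_def sum_3 algebra_simps)
  finally show "t3 = (\<Sum>s\<in>UNIV. \<Sum>t\<in>UNIV. AA s t * A s t)" .
qed

text \<open>The coefficients of the characteristic polynomial come from the power traces 5,
  \<open>b\<close>, \<open>t3\<close> by Newton's identities; the factor 6 clears
  denominators.\<close>

lemma cayley_hamilton:
  "6 *\<^sub>R M (M (M x)) = 30 *\<^sub>R M (M x) - (75 - 3 * b) *\<^sub>R M x + (125 - 15 * b
        + 2 * t3) *\<^sub>R x"
proof -
  obtain A11 A12 A13 A22 A23 A33 x1 x2 x3 where
    A: "A 1 2 = A12" "A 1 3 = A13" "A 2 2 = A22" "A 2 3 = A23" "A 3 3 = A33"
    and A': "A 2 1 = A12" "A 3 1 = A13" "A 3 2 = A23" and x: "x $ 1 = x1" "x $ 2 = x2" "x $ 3 = x3"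
    using A_sym by metis
  \<comment> \<open>Eliminating one diagonal entry by the trace turns the claim into a polynomial
    identity in each coordinate.\<close>
  have A11: "A 1 1 = 5 - A22 - A33"
    using traces(1) A by simp
  show ?thesis
    unfolding vec_eq_iff forall_3 vector_add_component vector_minus_component vector_scaleR_component
      real_scaleR_def M_component traces(2,3) AA_def sum_3 A A' A11 x
    by (intro conjI; simp add: algebra_simps power2_eq_square)
qed

text \<open>The Cayley-Hamilton identity applied to \<open>p i\<close>, paired with
  \<open>p i\<close> and summed: this is the trace of \<open>M\<close> times the identity.\<close>

lemma ch_trace: "6 * t4 = 40 * t3 - 150 * b + 3 * (b * b) + 625"
proof -
  have 1: "p i \<bullet> (6 *\<^sub>R M (M (M (p i)))) = 6 * (\<Sum>j\<in>{1..5}. (q i j)\<^sup>2)" for i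
  proof -
    have "p i \<bullet> M (M (M (p i))) = M (p i) \<bullet> M (M (p i))"
      by (rule M_sym[symmetric])
    also have "\<dots> = (\<Sum>j\<in>{1..5}. (q j i)\<^sup>2)"
      by (simp only: inner_M[of "M (p i)"] p_Mp power2_eq_square)
    also have "\<dots> = (\<Sum>j\<in>{1..5}. (q i j)\<^sup>2)"
      by (simp only: q_def u_def inner_commute mult.commute)
    finally show ?thesis by simp
  qed
  have 2: "p i \<bullet> M (M (p i)) = n i" for i
    using M_sym[of "p i" "M (p i)"] Mp_Mp[of i] by simp
  have "6 * t4 = (\<Sum>i\<in>{1..5}. p i \<bullet> (6 *\<^sub>R M (M (M (p i)))))"
    by (simp only: 1 t4_def sum_distrib_left)
  also have "\<dots> = (\<Sum>i\<in>{1..5}. 30 * n i - (75 - 3 * b) * m i + (125 - 15 * b + 2 * t3))"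
    unfolding cayley_hamilton
      by (rule sum.cong) (simp_all add: inner_add_right inner_diff_right 2 p_Mp' unit)
  also have "\<dots> = 30 * t3 - (75 - 3 * b) * b + 5 * (125 - 15 * b + 2 * t3)"
    unfolding sum.distrib sum_subtractf sum_distrib_left[symmetric] t3_def[symmetric] b_def[symmetric] by simp
  finally show ?thesis
    by (simp add: algebra_simps)
qed

text \<open>The Cayley-Hamilton identity applied to \<open>V\<close> and paired with
  \<open>V\<close>.\<close>

lemma ch_V: "6 * v3 = 30 * c2 - 75 * c + 3 * (b * c) + 125 * a - 15 * (a * b) + 2 * (a * t3)"
proof -
  have "V \<bullet> M (M (M V)) = M V \<bullet> M (M V)"
    by (rule M_sym[symmetric])
  also have "\<dots> = v3"
    by (simp only: inner_M[of "M V"] p_MV v3_def power2_eq_square)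
  finally have 1: "6 * v3 = V \<bullet> (6 *\<^sub>R M (M (M V)))"
    by simp
  have 2: "V \<bullet> M (M V) = c2"
    using M_sym[of V "M V"] MV_MV by simp
  show ?thesis
    unfolding 1 cayley_hamilton
    by (simp add: inner_add_right inner_diff_right V_V V_MV 2 algebra_simps)
qed

text \<open>The value \<open>edge_form h h\<close> at the combination \<open>h\<close> of
  \<open>g1\<close> to \<open>g4\<close> with these coefficients.\<close>

definition "G_form k1 k2 k3 k4 = k1\<^sup>2 * edge_form g1 g1 + k2\<^sup>2 * edge_form g2 g2
      + k3\<^sup>2 * edge_form g3 g3 + k4\<^sup>2 * edge_form g4 g4
    + 2 * (k1 * k2 * edge_form g1 g2 + k1 * k3 * edge_form g1 g3 + k1 * k4 * edge_form g1 g4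
    + k2 * k3 * edge_form g2 g3 + k2 * k4 * edge_form g2 g4 + k3 * k4 * edge_form g3 g4)"

lemma G_form_nonneg: "0 \<le> G_form k1 k2 k3 k4"
proof -
  define h where "h i j = k1 * g1 i j + (k2 * g2 i j + (k3 * g3 i j + k4 * g4 i j))" for i j
  have "h i j = h j i" "h i i = 0" for i j
    unfolding h_def g1_def g2_def g3_def g4_def off_diagonal_def q_def u_def
    by (simp_all add: inner_commute mult.commute add.commute)
  then have "0 \<le> edge_form h h"
    by (rule edge_form_nonneg)
  also have "edge_form h h = G_form k1 k2 k3 k4"
    unfolding G_form_def h_def edge_form_add_left edge_form_add_right edge_form_scale_left edge_form_scale_right
      edge_form_commute[of g2 g1] edge_form_commute[of g3 g1] edge_form_commute[of g4 g1]
      edge_form_commute[of g3 g2] edge_form_commute[of g4 g2] edge_form_commute[of g4 g3] power2_eq_square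
    by (simp add: algebra_simps)
  finally show ?thesis .
qed

definition "Z_form k1 k2 = k1\<^sup>2 * pairs (\<lambda>i j k l m'. z0 i j k l m' * z0 i j k l m')
    + k2\<^sup>2 * pairs (\<lambda>i j k l m'. z1 i j k l m' * z1 i j k l m')
    + 2 * (k1 * k2 * pairs (\<lambda>i j k l m'. z0 i j k l m' * z1 i j k l m'))"

lemma Z_form_nonneg: "0 \<le> Z_form k1 k2"
proof -
  have "0 \<le> pairs (\<lambda>i j k l m'. (k1 * z0 i j k l m' + k2 * z1 i j k l m')\<^sup>2)"
    unfolding pairs_def by (intro add_nonneg_nonneg zero_le_power2)
  then show ?thesis
    unfolding Z_form_def pairs_def power2_eq_square by (simp add: algebra_simps)
qed

end

subsection \<open>Hermite interpolation of the Coulomb potential\<close>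

lemma sqrt2_bounds: "1.41421356 < sqrt 2" "sqrt 2 < 1.41421357"
  by (rule real_less_rsqrt, simp add: power2_eq_square) (rule real_less_lsqrt, simp_all add: power2_eq_square)

lemma sqrt3_bounds: "1.73205080 < sqrt 3" "sqrt 3 < 1.73205081"
  by (rule real_less_rsqrt, simp add: power2_eq_square) (rule real_less_lsqrt, simp_all add: power2_eq_square)

text \<open>
  The Hermite interpolant of \<open>1 / sqrt (4 - 2 * w)\<close> at 0 (simple), 1/2 and 1 (double). For points at
  distance \<open>d\<close> on the sphere, \<open>w = (4 - d\<^sup>2) / 2\<close> is one plus their inner product.
\<close>

definition \<Gamma> :: "real \<Rightarrow> real" where
  "\<Gamma> w = 1 / 2 + (- 3 + 11 / 4 * sqrt 2 - 4 / 9 * sqrt 3) * w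
     + (13 / 2 - 53 / 4 * sqrt 2 + 64 / 9 * sqrt 3) * w\<^sup>2
     + (- 6 + 20 * sqrt 2 - 116 / 9 * sqrt 3) * w ^ 3
     + (2 - 9 * sqrt 2 + 56 / 9 * sqrt 3) * w ^ 4"

text \<open>The quotient of \<open>1 - d * \<Gamma> w\<close> by its zeros in the distance
  \<open>d\<close>: the values 0, 1/2, 1 of \<open>w\<close> correspond to \<open>d\<close> equal to
  2 (simple), \<open>sqrt 3\<close> and \<open>sqrt 2\<close> (double).\<close>

definition cofactor :: "real \<Rightarrow> real" where
  "cofactor d = 1 / 12 + (- 1 / 3 + 65 / 24 * sqrt 2 - 35 / 18 * sqrt 3) * d
     + (31 / 24 + 47 / 48 * sqrt 2 - 11 / 9 * sqrt 3 - 7 / 36 * (sqrt 2 * sqrt 3)) * d\<^sup>2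
     + (1 / 3 - 7 / 8 * sqrt 2 + 37 / 36 * sqrt 3 - 25 / 72 * (sqrt 2 * sqrt 3)) * d ^ 3
     + (1 / 8 - 9 / 16 * sqrt 2 + 7 / 18 * sqrt 3) * d ^ 4"

lemma hermite_remainder:
  "1 - d * \<Gamma> ((4 - d\<^sup>2) / 2) = (d - sqrt 2)\<^sup>2 * (d - sqrt 3)\<^sup>2 * (2
        - d) * cofactor d"
proof -
  obtain s q :: real where sq: "sqrt 2 = s" "sqrt 3 = q" by blast
  have s: "s * s = 2" and q: "q * q = 3"
    unfolding sq[symmetric] by simp_all
  \<comment> \<open>These rules reach squares inside longer products, so all terms reduce to 1,
    \<open>s\<close>, \<open>q\<close> and \<open>s * q\<close>.\<close>
  have s': "s * (s * x) = 2 * x" and q': "q * (q * x) = 3 * x" for x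
    using s q by (simp_all flip: mult.assoc)
  show ?thesis
    unfolding \<Gamma>_def cofactor_def sq power2_eq_square power3_eq_cube power4_eq_xxxx
    by (simp add: field_simps s q s' q')
qed

text \<open>All coefficients are nonnegative and the constant one is positive.\<close>

lemma cofactor_pos: "0 < cofactor d" if "0 \<le> d"
proof -
  \<comment> \<open>The product is a separate atom for linear arithmetic and needs its own
    bound.\<close>
  have "sqrt 2 * sqrt 3 < 2.44949"
    unfolding real_sqrt_mult[symmetric] by (rule real_less_lsqrt) (simp_all add: power2_eq_square)
  then have "0 \<le> - 1 / 3 + 65 / 24 * sqrt 2 - 35 / 18 * sqrt 3"
    "0 \<le> 31 / 24 + 47 / 48 * sqrt 2 - 11 / 9 * sqrt 3 - 7 / 36 * (sqrt 2 * sqrt 3)"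
    "0 \<le> 1 / 3 - 7 / 8 * sqrt 2 + 37 / 36 * sqrt 3 - 25 / 72 * (sqrt 2 * sqrt 3)"
    "0 \<le> 1 / 8 - 9 / 16 * sqrt 2 + 7 / 18 * sqrt 3"
    using sqrt2_bounds sqrt3_bounds by simp_all
  then show ?thesis
    unfolding cofactor_def using that
    by (intro add_pos_nonneg mult_nonneg_nonneg) simp_all
qed

lemma gamma_le:
  assumes "0 < d" "d \<le> 2"
  shows "\<Gamma> ((4 - d\<^sup>2) / 2) \<le> 1 / d"
    and "\<Gamma> ((4 - d\<^sup>2) / 2) = 1 / d \<Longrightarrow> d \<in> {sqrt 2, sqrt 3, 2}"
proof -
  note rem = hermite_remainder[of d]
  have pos: "0 < cofactor d"
    using assms cofactor_pos by simp
  have "0 \<le> 1 - d * \<Gamma> ((4 - d\<^sup>2) / 2)"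
    unfolding rem using assms pos by simp
  then show "\<Gamma> ((4 - d\<^sup>2) / 2) \<le> 1 / d"
    using assms by (simp add: field_simps)
  assume "\<Gamma> ((4 - d\<^sup>2) / 2) = 1 / d"
  then have "1 - d * \<Gamma> ((4 - d\<^sup>2) / 2) = 0"
    using assms by simp
  then show "d \<in> {sqrt 2, sqrt 3, 2}"
    unfolding rem using pos by auto
qed

text \<open>Comparing coefficients of \<open>w^4\<close>, \<open>w^2\<close>, \<open>w^3\<close>,
  \<open>w\<close> in this order determines \<open>k4\<close>, \<open>k3\<close>, \<open>k2\<close>,
  \<open>k1\<close> one after another.\<close>

lemma gamma_decomposition:
  obtains k0 k1 k2 k3 k4 where "0 < k1" "0 < k2" "0 < k3" "0 < k4"
    "\<And>w. \<Gamma> w = k0 + k1 * w + k2 * w ^ 3 + k3 * (2 * w\<^sup>2 + w ^ 3) + k4 * (24 * w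
          + 15 * w\<^sup>2 - 9 * w ^ 3 + 10 * w ^ 4)"
proof
  \<comment> \<open>The smallest of the four is about 0.001, hence the many digits in the bounds on
    the roots.\<close>
  show "0 < - 39 / 5 + 487 / 20 * sqrt 2 - 692 / 45 * sqrt 3"
    "0 < - 119 / 20 + 471 / 40 * sqrt 2 - 278 / 45 * sqrt 3"
    "0 < 7 / 4 + 1 / 8 * sqrt 2 - 10 / 9 * sqrt 3"
    "0 < 1 / 5 - 9 / 10 * sqrt 2 + 28 / 45 * sqrt 3"
    using sqrt2_bounds sqrt3_bounds by simp_all
  show "\<Gamma> w = 1 / 2 + (- 39 / 5 + 487 / 20 * sqrt 2 - 692 / 45 * sqrt 3) * w
    + (- 119 / 20 + 471 / 40 * sqrt 2 - 278 / 45 * sqrt 3) * w ^ 3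
    + (7 / 4 + 1 / 8 * sqrt 2 - 10 / 9 * sqrt 3) * (2 * w\<^sup>2 + w ^ 3)
    + (1 / 5 - 9 / 10 * sqrt 2 + 28 / 45 * sqrt 3) * (24 * w + 15 * w\<^sup>2 - 9 * w ^ 3
          + 10 * w ^ 4)" for w
    by (simp add: \<Gamma>_def field_simps)
qed

subsection \<open>Geometry of the bi-pyramid\<close>

lemma gram_det_3:
  fixes x y z :: "real^3"
  shows "(x \<bullet> cross3 y z)\<^sup>2 = (x \<bullet> x) * (y \<bullet> y) * (z \<bullet> z)
        + 2 * (x \<bullet> y) * (y \<bullet> z) * (z \<bullet> x)
    - (x \<bullet> x) * (y \<bullet> z)\<^sup>2 - (y \<bullet> y) * (z \<bullet> x)\<^sup>2
          - (z \<bullet> z) * (x \<bullet> y)\<^sup>2"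
  by (simp add: cross3_simps power2_eq_square)

text \<open>Up to the factor given by the triple product, \<open>n\<close> expands in the basis dual
  to \<open>x\<close>, \<open>y\<close>, \<open>z\<close>, with coefficients its inner products with
  them.\<close>

lemma triple_product_zero_if_coplanar:
  fixes n x y z :: "real^3"
  assumes "n \<noteq> 0" "x \<bullet> n = 0" "y \<bullet> n = 0" "z \<bullet> n = 0"
  shows "x \<bullet> cross3 y z = 0"
proof -
  have "(x \<bullet> cross3 y z) *\<^sub>R n = (x \<bullet> n) *\<^sub>R cross3 y z
        + (y \<bullet> n) *\<^sub>R cross3 z x + (z \<bullet> n) *\<^sub>R cross3 x y"
    by (simp add: cross3_simps vec_eq_iff forall_3)
  then show ?thesis
    using assms by simp
qed

lemma dist_sphere:
  fixes x y :: "real^3"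
  assumes "x \<in> S2" "y \<in> S2"
  shows "(dist x y)\<^sup>2 = 2 - 2 * (x \<bullet> y)"
  using assms
    by (simp add: dist_norm power2_norm_eq_inner inner_diff_left inner_diff_right inner_commute norm_eq_1)

text \<open>The third equatorial point is \<open>- x - y\<close>, so two of them suffice.\<close>

definition bipyramid_frame :: "real^3 \<Rightarrow> real^3 \<Rightarrow> real^3 \<Rightarrow> bool" where
  "bipyramid_frame n x y \<longleftrightarrow> n \<bullet> n = 1 \<and> x \<bullet> x = 1 \<and> y \<bullet> y = 1 \<and> x \<bullet> n = 0 \<and> y \<bullet> n = 0 \<and> x \<bullet> y = - 1 / 2"

text \<open>Three coplanar unit vectors with common inner product \<open>t\<close> have Gram
  determinant \<open>(1 - t)^2 * (1 + 2 * t) = 0\<close>. Distinctness excludes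
  \<open>t = 1\<close>, and at \<open>t = - 1 / 2\<close> the vectors sum to zero.\<close>

lemma triangular_bipyramid_iff_frame:
  "triangular_bipyramid T \<longleftrightarrow> (\<exists>n x y. bipyramid_frame n x y \<and> T = {n,
        - n, x, y, - x - y})"
proof
  assume "triangular_bipyramid T"
  then obtain n x y z where n: "n \<in> S2" and xyz: "x \<in> S2" "y \<in> S2" "z \<in> S2"
    and perp: "x \<bullet> n = 0" "y \<bullet> n = 0" "z \<bullet> n = 0" and "x \<noteq> y"
    and dist: "dist x y = dist y z" "dist y z = dist z x" and T: "T = {n, - n, x, y, z}"
    unfolding triangular_bipyramid_def by auto
  define t where "t = x \<bullet> y"
  have t: "y \<bullet> z = t" "z \<bullet> x = t"
    using dist_sphere[of x y] dist_sphere[of y z] dist_sphere[of z x] xyz dist by (simp_all add: t_def)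
  have unit: "n \<bullet> n = 1" "x \<bullet> x = 1" "y \<bullet> y = 1" "z \<bullet> z = 1"
    using n xyz by (simp_all add: norm_eq_1)
  have "n \<noteq> 0"
    using unit by auto
  then have "(x \<bullet> cross3 y z)\<^sup>2 = 0"
    using triple_product_zero_if_coplanar perp by simp
  then have "1 + 2 * t * t * t - 3 * t\<^sup>2 = 0"
    unfolding gram_det_3 by (simp add: unit t t_def[symmetric])
  then have "(1 - t)\<^sup>2 * (1 + 2 * t) = 0"
    by (simp add: power2_eq_square algebra_simps)
  moreover have "t \<noteq> 1"
    using dist_sphere[of x y] xyz \<open>x \<noteq> y\<close> by (auto simp: t_def)
  ultimately have t_eq: "t = - 1 / 2"
    by simp
  have "(x + y + z) \<bullet> (x + y + z) = 0"
    using t t_def t_eq unit by (simp add: inner_add_left inner_add_right inner_commute)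
  then have "x + y + z = 0"
    by (simp only: inner_eq_zero_iff)
  then have "z = - x - y"
    by (simp add: add_eq_0_iff)
  then show "\<exists>n x y. bipyramid_frame n x y \<and> T = {n, - n, x, y, - x - y}"
    using unit perp T t_eq unfolding bipyramid_frame_def t_def by blast
next
  assume "\<exists>n x y. bipyramid_frame n x y \<and> T = {n, - n, x, y, - x - y}"
  then obtain n x y where f: "bipyramid_frame n x y" and T: "T = {n, - n, x, y, - x - y}"
    by blast
  define z where "z = - x - y"
  have eqs: "n \<bullet> n = 1" "x \<bullet> x = 1" "y \<bullet> y = 1" "z \<bullet> z = 1" "x \<bullet> n = 0" "y \<bullet> n = 0" "z \<bullet> n = 0"
    "x \<bullet> y = - 1 / 2" "y \<bullet> z = - 1 / 2" "z \<bullet> x = - 1 / 2"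
    using f unfolding bipyramid_frame_def z_def
    by (simp_all add: inner_diff_left inner_diff_right inner_commute)
  then have S: "n \<in> S2" "x \<in> S2" "y \<in> S2" "z \<in> S2"
    by (simp_all add: norm_eq_1)
  have "(dist x y)\<^sup>2 = 3" "(dist y z)\<^sup>2 = 3" "(dist z x)\<^sup>2 = 3"
    using dist_sphere S eqs by simp_all
  then have "dist x y = sqrt 3" "dist y z = sqrt 3" "dist z x = sqrt 3"
    by (metis real_sqrt_unique zero_le_dist)+
  then show "triangular_bipyramid T"
    unfolding triangular_bipyramid_def T z_def[symmetric] using S eqs
      by (intro exI[of _ n] exI[of _ x] exI[of _ y] exI[of _ z]) auto
qed

lemma orthonormal_expansion:
  fixes e1 e2 e3 x :: "real^3"
  assumes "e1 \<bullet> e1 = 1" "e2 \<bullet> e2 = 1" "e3 \<bullet> e3 = 1" "e1 \<bullet> e2 = 0" "e1 \<bullet> e3 = 0" "e2 \<bullet> e3 = 0"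
  shows "x = (x \<bullet> e1) *\<^sub>R e1 + (x \<bullet> e2) *\<^sub>R e2
        + (x \<bullet> e3) *\<^sub>R e3"
proof -
  let ?B = "{e1, e2, e3}"
  have neq: "e1 \<noteq> e2" "e1 \<noteq> e3" "e2 \<noteq> e3"
    using assms by auto
  have orth: "pairwise orthogonal ?B"
    using assms by (auto simp: pairwise_def orthogonal_def inner_commute)
  moreover have "0 \<notin> ?B"
    using assms by auto
  ultimately have "independent ?B"
    by (rule pairwise_orthogonal_independent)
  moreover have "card ?B = dim (UNIV :: (real^3) set)"
    using neq by simp
  ultimately have "UNIV \<subseteq> span ?B"
    by (intro card_ge_dim_independent) auto
  then have "(\<Sum>e\<in>?B. (x \<bullet> e) *\<^sub>R e) = x"
    using orth assms by (intro orthonormal_basis_expand) (auto simp: norm_eq_1)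
  then show ?thesis
    using neq by (simp add: add.assoc)
qed

text \<open>A frame extends to an orthonormal basis in which its points have fixed coordinates; the
  linear map between two such bases is the isometry.\<close>

lemma triangular_bipyramids_isometric:
  assumes "triangular_bipyramid S" "triangular_bipyramid T"
  shows "\<exists>f. sphere_isometry f \<and> T = f ` S"
proof -
  have onb: "\<exists>e. e \<bullet> e = 1 \<and> n \<bullet> e = 0 \<and> x \<bullet> e = 0 \<and> y = (- 1 / 2) *\<^sub>R x + (sqrt 3 / 2) *\<^sub>R e"
    if "bipyramid_frame n x y" for n x y
  proof -
    \<comment> \<open>Gram-Schmidt: the normalized part of \<open>y\<close> orthogonal to
      \<open>x\<close>.\<close>
    define e where "e = (1 / sqrt 3) *\<^sub>R (x + 2 *\<^sub>R y)"
    have "(x + 2 *\<^sub>R y) \<bullet> (x + 2 *\<^sub>R y) = 3"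
      using that unfolding bipyramid_frame_def
        by (simp add: inner_add_left inner_add_right inner_commute)
    then have "e \<bullet> e = 1"
      by (simp add: e_def)
    moreover have "n \<bullet> e = 0" "x \<bullet> e = 0"
      using that unfolding bipyramid_frame_def e_def by (simp_all add: inner_add_right inner_commute)
    moreover have "y = (- 1 / 2) *\<^sub>R x + (sqrt 3 / 2) *\<^sub>R e"
      by (simp add: e_def algebra_simps flip: scaleR_add_left)
    ultimately show ?thesis by blast
  qed
  obtain n x y where fr: "bipyramid_frame n x y" and S: "S = {n, - n, x, y, - x - y}"
    using assms(1) triangular_bipyramid_iff_frame by blast
  obtain n' x' y' where fr': "bipyramid_frame n' x' y'" and T: "T = {n', - n', x', y', - x' - y'}"
    using assms(2) triangular_bipyramid_iff_frame by blast
  obtain e where e: "e \<bullet> e = 1" "n \<bullet> e = 0" "x \<bullet> e = 0" and y: "y = (- 1 / 2) *\<^sub>R x + (sqrt 3 / 2) *\<^sub>R e"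
    using onb[OF fr] by blast
  obtain e' where e': "e' \<bullet> e' = 1" "n' \<bullet> e' = 0" "x' \<bullet> e' = 0"
    and y': "y' = (- 1 / 2) *\<^sub>R x' + (sqrt 3 / 2) *\<^sub>R e'"
    using onb[OF fr'] by blast
  have nx: "n \<bullet> n = 1" "x \<bullet> x = 1" "n \<bullet> x = 0"
        and nx': "n' \<bullet> n' = 1" "x' \<bullet> x' = 1" "n' \<bullet> x' = 0"
    using fr fr' unfolding bipyramid_frame_def by (simp_all add: inner_commute)
  define f where "f v = (v \<bullet> n) *\<^sub>R n' + (v \<bullet> x) *\<^sub>R x'
        + (v \<bullet> e) *\<^sub>R e'" for v
  \<comment> \<open>The inverse of \<open>f\<close>, needed for surjectivity on the sphere.\<close>
  define g where "g v = (v \<bullet> n') *\<^sub>R n + (v \<bullet> x') *\<^sub>R x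
        + (v \<bullet> e') *\<^sub>R e" for v
  note ips = nx nx' e e' inner_commute[of x n] inner_commute[of e n] inner_commute[of e x]
    inner_commute[of x' n'] inner_commute[of e' n'] inner_commute[of e' x']
  have isom: "f v \<bullet> f v = v \<bullet> v" for v
  proof -
    have "v \<bullet> v = v \<bullet> ((v \<bullet> n) *\<^sub>R n + (v \<bullet> x) *\<^sub>R x
          + (v \<bullet> e) *\<^sub>R e)"
      using orthonormal_expansion[of n x e v] nx e by simp
    then show ?thesis
      by (simp add: f_def inner_add_left inner_add_right ips)
  qed
  have linear_f: "f (v + w) = f v + f w" "f (k *\<^sub>R v) = k *\<^sub>R f v" for v w k
    by (simp_all add: f_def inner_add_left algebra_simps)
  have minus_f: "f (- v) = - f v" "f (v - w) = f v - f w" for v w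
    using linear_f(2)[of "- 1"] linear_f(1)[of v "- w"] by simp_all
  have dist: "dist (f v) (f w) = dist v w" for v w
    by (simp add: dist_norm norm_eq_sqrt_inner isom flip: minus_f)
  have fg: "f (g w) = w" for w
    using orthonormal_expansion[of n' x' e' w] nx' e'
    by (simp add: f_def g_def inner_add_left ips)
  have norm_f: "norm (f v) = norm v" for v
    by (simp add: norm_eq_sqrt_inner isom)
  have "f ` S2 = S2"
  proof
    show "f ` S2 \<subseteq> S2"
      by (auto simp: norm_f)
    show "S2 \<subseteq> f ` S2"
    proof
      fix w assume "w \<in> S2"
      then have "g w \<in> S2"
        using norm_f[of "g w"] by (simp add: fg)
      then show "w \<in> f ` S2"
        using fg by (metis imageI)
    qed
  qed
  then have "sphere_isometry f"
    by (simp add: sphere_isometry_def dist)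
  moreover have fn: "f n = n'" "f x = x'" "f e = e'"
    by (simp_all add: f_def ips)
  moreover have "f y = y'"
    unfolding y y' linear_f fn ..
  ultimately show ?thesis
    unfolding S T by (intro exI[of _ f]) (simp add: minus_f)
qed

section \<open>The energy of the bi-pyramid\<close>

lemma sum_strict_pairs:
  fixes f :: "'a :: linorder \<Rightarrow> 'a \<Rightarrow> real"
  assumes fin: "finite A" and sym: "\<And>i j. f i j = f j i"
  shows "(\<Sum>(i, j)\<in>{(i, j). i \<in> A \<and> j \<in> A \<and> i > j}. f i j) =
    ((\<Sum>i\<in>A. \<Sum>j\<in>A. f i j) - (\<Sum>i\<in>A. f i i)) / 2"
proof -
  let ?f = "\<lambda>(i, j). f i j"
  let ?U = "{(i, j). i \<in> A \<and> j \<in> A \<and> i > j}" and ?L = "{(i, j). i \<in> A \<and> j \<in> A \<and> i < j}"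
  let ?D = "(\<lambda>i. (i, i)) ` A"
  have finite: "finite ?U" "finite ?L" "finite ?D"
    using fin by (auto intro: finite_subset[OF _ finite_cartesian_product[OF fin fin]])
  have "A \<times> A = ?U \<union> (?L \<union> ?D)"
    by auto
  moreover have "sum ?f (?U \<union> (?L \<union> ?D)) = sum ?f ?U + (sum ?f ?L + sum ?f ?D)"
    using finite by (subst sum.union_disjoint, auto)+
  moreover have "sum ?f ?L = sum ?f ?U"
    by (rule sum.reindex_bij_witness[of _ prod.swap prod.swap]) (auto simp: sym)
  moreover have "sum ?f ?D = (\<Sum>i\<in>A. f i i)"
    by (subst sum.reindex) (auto simp: inj_on_def)
  ultimately show ?thesis
    by (simp add: sum.cartesian_product)
qed

text \<open>The diagonal contributes nothing, because \<open>1 / 0 = 0\<close>.\<close>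

lemma coulomb_energy_eq: "coulomb_energy p = (\<Sum>i\<in>{1..5}. \<Sum>j\<in>{1..5}. 1 / norm (p i
      - p j)) / 2"
  unfolding coulomb_energy_def by (subst sum_strict_pairs) (simp_all add: norm_minus_commute)

text \<open>Six distances from a pole to the equator are \<open>sqrt 2\<close>, three along the
  equator are \<open>sqrt 3\<close>, and the poles are at distance 2.\<close>

lemma triangular_bipyramid_energy:
  assumes "triangular_bipyramid (p ` {1..5})"
  shows "configuration p" and "coulomb_energy p = 6 / sqrt 2 + 3 / sqrt 3 + 1 / 2"
proof -
  obtain n x y where f: "bipyramid_frame n x y" and T: "p ` {1..5} = {n, - n, x, y, - x - y}"
    using iffD1[OF triangular_bipyramid_iff_frame assms] by (elim exE conjE)
  define z where "z = - x - y"
  have unit: "n \<bullet> n = 1" "x \<bullet> x = 1" "y \<bullet> y = 1" and perp: "x \<bullet> n = 0" "y \<bullet> n = 0" and xy: "x \<bullet> y = - 1 / 2"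
    using f by (simp_all add: bipyramid_frame_def)
  have perp': "n \<bullet> x = 0" "n \<bullet> y = 0" and yx: "y \<bullet> x = - 1 / 2"
    using perp xy by (simp_all add: inner_commute[of n] inner_commute[of y x])
  have z: "z \<bullet> n = 0" "n \<bullet> z = 0" "x \<bullet> z = - 1 / 2" "z \<bullet> x =
        - 1 / 2" "y \<bullet> z = - 1 / 2" "z \<bullet> y = - 1 / 2" "z \<bullet> z = 1"
    unfolding z_def inner_diff_left inner_diff_right inner_minus_left inner_minus_right
    by (simp_all add: unit perp perp' xy yx)
  note unit = unit z(7) and perp = perp perp' z(1,2) and ang = xy yx z(3-6)
  have unit': "(- n) \<bullet> (- n) = 1"
    using unit(1) by simp
  have differ: "v \<noteq> w" if "v \<bullet> v = 1" "v \<bullet> w \<le> 0" for v w :: "real^3"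
    using that by auto
  have "n \<noteq> - n" "n \<noteq> x" "n \<noteq> y" "n \<noteq> z" "- n \<noteq> x" "- n \<noteq> y" "- n \<noteq> z" "x \<noteq> y" "x \<noteq> z" "y \<noteq> z"
    by (rule differ; simp add: unit perp ang)+
  then have neq: "n \<notin> {- n, x, y, z}" "- n \<notin> {x, y, z}" "x \<notin> {y, z}" "y \<notin> {z}"
    by simp_all
  have T': "p ` {1..5} = {n, - n, x, y, z}"
    unfolding T z_def ..
  \<comment> \<open>The image has five elements, so the labelling is injective and sums over labels
    become sums over points.\<close>
  have "card (p ` {1..5}) = card {1..5::nat}"
    unfolding T' using neq by simp
  then have inj: "inj_on p {1..5}"
    by (intro eq_card_imp_inj_on) auto
  moreover have "p ` {1..5} \<subseteq> S2"
    unfolding T' using unit by (simp add: norm_eq_1)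
  ultimately show "configuration p"
    by (simp add: configuration_def)
  have "coulomb_energy p = (\<Sum>v\<in>p ` {1..5}. \<Sum>w\<in>p ` {1..5}. 1 / norm (v - w)) / 2"
    unfolding coulomb_energy_eq sum.reindex[OF inj] by simp
  also have "\<dots> = 6 / sqrt 2 + 3 / sqrt 3 + 1 / 2"
  proof -
    have sum_T: "(\<Sum>v\<in>{n, - n, x, y, z}. g v) = g n + (g (- n) + (g x + (g y
          + g z)))" for g :: "_ \<Rightarrow> real"
      using neq by simp
    have norm_diff: "norm (v - w) = sqrt (2
          - 2 * (v \<bullet> w))" if "v \<bullet> v = 1" "w \<bullet> w = 1" for v w :: "real^3"
      using that by (simp add: norm_eq_sqrt_inner inner_diff_left inner_diff_right inner_commute)
    note norms = norm_diff[OF unit(1) unit'] norm_diff[OF unit' unit(1)]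
      norm_diff[OF unit(1) unit(2)] norm_diff[OF unit(1) unit(3)] norm_diff[OF unit(1) unit(4)]
      norm_diff[OF unit(2) unit(1)] norm_diff[OF unit(3) unit(1)] norm_diff[OF unit(4) unit(1)]
      norm_diff[OF unit' unit(2)] norm_diff[OF unit' unit(3)] norm_diff[OF unit' unit(4)]
      norm_diff[OF unit(2) unit'] norm_diff[OF unit(3) unit'] norm_diff[OF unit(4) unit']
      norm_diff[OF unit(2) unit(3)] norm_diff[OF unit(3) unit(2)] norm_diff[OF unit(2) unit(4)]
      norm_diff[OF unit(4) unit(2)] norm_diff[OF unit(3) unit(4)] norm_diff[OF unit(4) unit(3)]
    show ?thesis
      unfolding T' sum_T norms diff_self norm_zero inner_minus_left inner_minus_right unit perp ang
      by simp
  qed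
  finally show "coulomb_energy p = 6 / sqrt 2 + 3 / sqrt 3 + 1 / 2" .
qed

section \<open>Pair sums of potentials\<close>

context five_points
begin

definition "pair_sum f = (\<Sum>(i, j)\<in>{(i, j). i \<in> {1..5::nat} \<and> j \<in> {1..5} \<and> i > j}. f (1 + u i j) :: real)"

lemma pair_sum_eq: "pair_sum f = ((\<Sum>i\<in>{1..5}. \<Sum>j\<in>{1..5}. f (1 + u i j)) - 5 * f 2) / 2"
proof -
  \<comment> \<open>On the diagonal \<open>w\<close> equals 2.\<close>
  have "(\<Sum>i\<in>{1..5}. f (1 + u i i)) = (\<Sum>i\<in>{1..5::nat}. f 2)"
    by (rule sum.cong) (simp_all add: u_def unit)
  then show ?thesis
    unfolding pair_sum_def by (subst sum_strict_pairs) (simp_all add: u_def inner_commute)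
qed

lemma pair_sums:
  "pair_sum (\<lambda>w. w) = (15 + a) / 2"
  "pair_sum (\<lambda>w. w\<^sup>2) = (5 + 2 * a + b) / 2"
  "pair_sum (\<lambda>w. w ^ 3) = (- 15 + 3 * a + 3 * b + e3) / 2"
  "pair_sum (\<lambda>w. w ^ 4) = (- 55 + 4 * a + 6 * b + 4 * e3 + e4) / 2"
  unfolding pair_sum_eq defs
    by (simp_all add: sum.distrib sum_distrib_left power2_eq_square power3_eq_cube power4_eq_xxxx algebra_simps)

lemma pair_sum_linear:
  "pair_sum (\<lambda>w. f w + g w) = pair_sum f + pair_sum g"
  "pair_sum (\<lambda>w. f w - g w) = pair_sum f - pair_sum g"
  "pair_sum (\<lambda>w. k * f w) = k * pair_sum f"
  "pair_sum (\<lambda>w. k) = 10 * k"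
  unfolding pair_sum_eq by (simp_all add: sum.distrib sum_subtractf sum_distrib_left field_simps)

subsection \<open>The three polynomial inequalities\<close>

text \<open>
  The coefficients were found by solving a semidefinite program numerically and rounding to an exact
  rational solution. In each block, the rows of the forms are those of a Cholesky-type elimination.
\<close>

lemma cert_cubic: "111 \<le> 12 * a + 12 * b + 4 * e3"
proof -
  \<comment> \<open>The four blocks are the squares from cross products, from edge forms, from
    alternating polynomials, and from polynomials in \<open>a\<close>, \<open>b\<close>,
    \<open>c\<close>.\<close>
  have W: "0 \<le> 562069010400 * (5 * a - c)
      - 121648988160 * (a * a - s3)
      - 321931221120 * (b * a - c2)
      + 10973491200 * (5 * (a * a) - a * c)
      - 219398697600 * (5 * c - c2)
      + 78606028800 * (t3 - mm)
      - 83441122560 * (c2 - mr2)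
      + 11287019520 * (my - rn)
      + 34458106752 * (a * c - a * d1)
      - 74662963200 * (c2 - my)
      + 32091012288 * (c * a - s4)
      + 21946982400 * (a * d1 - r2y)
      - 20041356672 * (a * a * a - a * s3)
      + 65366533632 * (c * a - r2y)
      + 50991669120 * (t3 * a - v3)
      + 50086713600 * (c * b - v3)
      + 3997486080 * (5 * (a * a * a) - a * a * c)
      - 22858486272 * (5 * (a * c) - a * c2)
      + 75168414720 * (5 * c2 - v3)"
  proof (rule nonneg_if_multiple)
    show "574273457771099209526656837488991208074332604258900549021466690440884567011439067479043475625 * (562069010400 * (5 * a - c)
      - 121648988160 * (a * a - s3)
      - 321931221120 * (b * a - c2)
      + 10973491200 * (5 * (a * a) - a * c)
      - 219398697600 * (5 * c - c2)
      + 78606028800 * (t3 - mm)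
      - 83441122560 * (c2 - mr2)
      + 11287019520 * (my - rn)
      + 34458106752 * (a * c - a * d1)
      - 74662963200 * (c2 - my)
      + 32091012288 * (c * a - s4)
      + 21946982400 * (a * d1 - r2y)
      - 20041356672 * (a * a * a - a * s3)
      + 65366533632 * (c * a - r2y)
      + 50991669120 * (t3 * a - v3)
      + 50086713600 * (c * b - v3)
      + 3997486080 * (5 * (a * a * a) - a * a * c)
      - 22858486272 * (5 * (a * c) - a * c2)
      + 75168414720 * (5 * c2 - v3)) =
      235402774787921767755480822995865303340563306781538024631407299301231506285932680460000 * W_form 1170977105 0 (-126717696) (-335345022) 11430720 (-228540310)
      + 2423861803402339177067244222808868663392772414303684917258485556361230629994466888167325 * W_form 0 136468800 (-72431530) 9797760 29911551 (-64811600)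
      + 5542369268029929191180627362156174605848350904327497932475 * W_form 0 0 18673855656993070972670 (-19143684317245550186880) (-1567600427331769071117) 5538877290455315636080
      + 4080679910685188283986784746315566953852791088 * W_form 0 0 0 11575597900976883533445286000 543599933834928025388343024 (-32446314864763057157309660445)
      + 6417454839480522415191872171667312 * W_form 0 0 0 0 3562254641780772747893151571945149 (-49408839796221801358306423163411320)
      + 557912176949641018575252157875780770293590627901648436794538153438990644805085891463818617313329730000 * W_form 0 0 0 0 0 1"
      unfolding W_form_def power2_eq_square by (simp add: algebra_simps)
    show "0 \<le> 235402774787921767755480822995865303340563306781538024631407299301231506285932680460000 * W_form 1170977105 0 (-126717696) (-335345022) 11430720 (-228540310)
      + 2423861803402339177067244222808868663392772414303684917258485556361230629994466888167325 * W_form 0 136468800 (-72431530) 9797760 29911551 (-64811600)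
      + 5542369268029929191180627362156174605848350904327497932475 * W_form 0 0 18673855656993070972670 (-19143684317245550186880) (-1567600427331769071117) 5538877290455315636080
      + 4080679910685188283986784746315566953852791088 * W_form 0 0 0 11575597900976883533445286000 543599933834928025388343024 (-32446314864763057157309660445)
      + 6417454839480522415191872171667312 * W_form 0 0 0 0 3562254641780772747893151571945149 (-49408839796221801358306423163411320)
      + 557912176949641018575252157875780770293590627901648436794538153438990644805085891463818617313329730000 * W_form 0 0 0 0 0 1"
      by (intro add_nonneg_nonneg mult_nonneg_nonneg W_form_nonneg zero_le_numeral)
  qed simp
  have G: "0 \<le> 392584320 * edge_form g1 g1
      - 876461696 * (2 * edge_form g1 g4)
      + 28213920 * edge_form g2 g2
      + 192621776 * edge_form g2 g4
      + 138492180 * (4 * edge_form g3 g3)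
      + 146043027 * (16 * edge_form g4 g4)"
  proof (rule nonneg_if_multiple)
    show "6677000505 * (392584320 * edge_form g1 g1
      - 876461696 * (2 * edge_form g1 g4)
      + 28213920 * edge_form g2 g2
      + 192621776 * edge_form g2 g4
      + 138492180 * (4 * edge_form g3 g3)
      + 146043027 * (16 * edge_form g4 g4)) =
      278656 * G_form 3067065 0 0 (-6847357)
      + 15146 * G_form 0 3526740 0 12038861
      + 3698849423194203600 * G_form 0 0 1 0
      + 341748614834277750 * G_form 0 0 0 1"
      unfolding G_form_def power2_eq_square by (simp add: algebra_simps)
    show "0 \<le> 278656 * G_form 3067065 0 0 (-6847357)
      + 15146 * G_form 0 3526740 0 12038861
      + 3698849423194203600 * G_form 0 0 1 0
      + 341748614834277750 * G_form 0 0 0 1"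
      by (intro add_nonneg_nonneg mult_nonneg_nonneg G_form_nonneg zero_le_numeral)
  qed simp
  have Z: "0 \<le> 106254900 * (128 * pairs (\<lambda>i j k l m'. z0 i j k l m' * z0 i j k l m'))
      - 215550720 * (64 * pairs (\<lambda>i j k l m'. z0 i j k l m' * z1 i j k l m'))
      + 29838195 * (128 * pairs (\<lambda>i j k l m'. z1 i j k l m' * z1 i j k l m'))"
  proof (rule nonneg_if_multiple)
    show "118061 * (106254900 * (128 * pairs (\<lambda>i j k l m'. z0 i j k l m' * z0 i j k l m'))
      - 215550720 * (64 * pairs (\<lambda>i j k l m'. z0 i j k l m' * z1 i j k l m'))
      + 29838195 * (128 * pairs (\<lambda>i j k l m'. z1 i j k l m' * z1 i j k l m'))) =
      4608 * Z_form 590305 (-299376)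
      + 37912514861952 * Z_form 0 1"
      unfolding Z_form_def power2_eq_square by (simp add: algebra_simps)
    show "0 \<le> 4608 * Z_form 590305 (-299376)
      + 37912514861952 * Z_form 0 1"
      by (intro add_nonneg_nonneg mult_nonneg_nonneg Z_form_nonneg zero_le_numeral)
  qed simp
  \<comment> \<open>The squared expressions vanish at the bi-pyramid, where \<open>a = 0\<close>,
    \<open>c = 0\<close> and \<open>b = 17 / 2\<close>.\<close>
  have S: "0 \<le> 90133220160 * (a * a)
      - 80644991136 * (a * c)
      + 5486745600 * (a * (a * a))
      + 1756080000 * ((2 * b - 17) * (2 * b - 17))
      + 19611601392 * (c * c)
      - 3187532448 * (c * (a * a))
      + 173944080 * ((a * a) * (a * a))"
  proof (rule nonneg_if_multiple)
    show "9627479622366328647702215 * (90133220160 * (a * a)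
      - 80644991136 * (a * c)
      + 5486745600 * (a * (a * a))
      + 1756080000 * ((2 * b - 17) * (2 * b - 17))
      + 19611601392 * (c * c)
      - 3187532448 * (c * (a * a))
      + 173944080 * ((a * a) * (a * a))) =
      246099196395692396 * (1877775420 * a + (-840051991) * c + 57153600 * (a * a))\<^sup>2
      + 16906624415245062411656905717200000 * (1 * (2 * b - 17))\<^sup>2
      + 4 * (61524799098923099 * c + (-14336651207461860) * (a * a))\<^sup>2
      + 48593423586919703943842951338800 * (1 * (a * a))\<^sup>2"
      unfolding power2_eq_square by (simp add: algebra_simps)
    show "0 \<le> 246099196395692396 * (1877775420 * a + (-840051991) * c + 57153600 * (a * a))\<^sup>2
      + 16906624415245062411656905717200000 * (1 * (2 * b - 17))\<^sup>2
      + 4 * (61524799098923099 * c + (-14336651207461860) * (a * a))\<^sup>2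
      + 48593423586919703943842951338800 * (1 * (a * a))\<^sup>2"
      by (intro add_nonneg_nonneg mult_nonneg_nonneg zero_le_power2 zero_le_numeral)
  qed simp
  show ?thesis
    \<comment> \<open>After inserting the tables, everything is linear in monomials of the
      invariants. Modulo the relations, the sum of the blocks is a positive multiple of the
      difference of the two sides.\<close>
    using add_nonneg_nonneg[OF add_nonneg_nonneg[OF W S] add_nonneg_nonneg[OF G Z]]
      ch_trace ch_V rel_aaa rel_aac rel_aaaa
    unfolding g11 g12 g13 g14 g22 g23 g24 g33 g34 g44 z00 z01 z11 by (simp add: algebra_simps)
qed

text \<open>By \<open>pair_sums\<close>, this is the bound 159/8 for the potential
  \<open>2 * w^2 + w^3\<close>.\<close>

lemma cert_quadratic_cubic: "179 \<le> 28 * a + 20 * b + 4 * e3"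
proof -
  have W: "0 \<le> 2212646978880 * (5 * a - c)
      + 1139292241920 * (c - d1)
      - 551189314560 * (a * a - s3)
      - 1017208598400 * (b * a - c2)
      + 94609041024 * (5 * (a * a) - a * c)
      - 1215062745600 * (5 * c - c2)
      + 275009126400 * (t3 - mm)
      - 297921576960 * (c2 - mr2)
      - 155788738560 * (my - rn)
      + 86951854080 * (a * c - a * d1)
      - 473336893440 * (c2 - my)
      + 85339564800 * (c * a - s4)
      + 51907829760 * (a * d1 - r2y)
      - 46521753600 * (a * a * a - a * s3)
      + 223789547520 * (c * a - r2y)
      + 151770862080 * (t3 * a - v3)
      + 207566029440 * (c * b - v3)
      + 9547975104 * (5 * (a * a * a) - a * a * c)
      - 82193967360 * (5 * (a * c) - a * c2)
      + 358600222080 * (5 * c2 - v3)"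
  proof (rule nonneg_if_multiple)
    show "12964022095689380671304904172860869923101170197284484998562653794927775887234799942461953585095 * (2212646978880 * (5 * a - c)
      + 1139292241920 * (c - d1)
      - 551189314560 * (a * a - s3)
      - 1017208598400 * (b * a - c2)
      + 94609041024 * (5 * (a * a) - a * c)
      - 1215062745600 * (5 * c - c2)
      + 275009126400 * (t3 - mm)
      - 297921576960 * (c2 - mr2)
      - 155788738560 * (my - rn)
      + 86951854080 * (a * c - a * d1)
      - 473336893440 * (c2 - my)
      + 85339564800 * (c * a - s4)
      + 51907829760 * (a * d1 - r2y)
      - 46521753600 * (a * a * a - a * s3)
      + 223789547520 * (c * a - r2y)
      + 151770862080 * (t3 * a - v3)
      + 207566029440 * (c * b - v3)
      + 9547975104 * (5 * (a * a * a) - a * a * c)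
      - 82193967360 * (5 * (a * c) - a * c2)
      + 358600222080 * (5 * c2 - v3)) =
      215988232690151119217378834174355008552010021829576482840538498499033338172156592206016 * W_form 11524203015 2966906880 (-1435388840) (-2648980725) 246377711 (-3164225900)
      + 58134914345340702504919357094341127254315085552755443930551590308479209216 * W_form 0 5350021730938440 (-3251557736337960) 2211049874081160 1304533066088448 (-3345363923140285)
      + 86508929947926486078713575386873318013385281362603541588939246848 * W_form 0 0 23233158319445847015 (-33253832557797665490) 10659299596152509046 (-80980310399517833120)
      + 3980965874459904325602175758037295940823622534495552 * W_form 0 0 0 134559476540196550734216915 7364937653741768483931183 (-500138124928600113932133055)
      + 1822544131609103433389574148084540572736 * W_form 0 0 0 0 30448780522196543607950828457813 (-384767207664078409336414096212985)
      + 2821536383827182950601929077919409555554187377358441690580500357922019853291529394587001747918448166400 * W_form 0 0 0 0 0 1"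
      unfolding W_form_def power2_eq_square by (simp add: algebra_simps)
    show "0 \<le> 215988232690151119217378834174355008552010021829576482840538498499033338172156592206016 * W_form 11524203015 2966906880 (-1435388840) (-2648980725) 246377711 (-3164225900)
      + 58134914345340702504919357094341127254315085552755443930551590308479209216 * W_form 0 5350021730938440 (-3251557736337960) 2211049874081160 1304533066088448 (-3345363923140285)
      + 86508929947926486078713575386873318013385281362603541588939246848 * W_form 0 0 23233158319445847015 (-33253832557797665490) 10659299596152509046 (-80980310399517833120)
      + 3980965874459904325602175758037295940823622534495552 * W_form 0 0 0 134559476540196550734216915 7364937653741768483931183 (-500138124928600113932133055)
      + 1822544131609103433389574148084540572736 * W_form 0 0 0 0 30448780522196543607950828457813 (-384767207664078409336414096212985)
      + 2821536383827182950601929077919409555554187377358441690580500357922019853291529394587001747918448166400 * W_form 0 0 0 0 0 1"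
      by (intro add_nonneg_nonneg mult_nonneg_nonneg W_form_nonneg zero_le_numeral)
  qed simp
  have G: "0 \<le> 927360000 * edge_form g1 g1
      + 9676800 * (8 * edge_form g1 g2)
      - 1928016480 * (2 * edge_form g1 g4)
      + 32932800 * edge_form g2 g2
      + 85639680 * (4 * edge_form g3 g3)
      + 266212845 * (16 * edge_form g4 g4)"
  proof (rule nonneg_if_multiple)
    show "5033314825 * (927360000 * edge_form g1 g1
      + 9676800 * (8 * edge_form g1 g2)
      - 1928016480 * (2 * edge_form g1 g4)
      + 32932800 * edge_form g2 g2
      + 85639680 * (4 * edge_form g3 g3)
      + 266212845 * (16 * edge_form g4 g4)) =
      1250513 * G_form 1932000 80640 0 (-4016701)
      + 4032 * G_form 0 6252565 0 16066804
      + 1724205883809024000 * G_form 0 0 1 0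
      + 222464298057433975 * G_form 0 0 0 1"
      unfolding G_form_def power2_eq_square by (simp add: algebra_simps)
    show "0 \<le> 1250513 * G_form 1932000 80640 0 (-4016701)
      + 4032 * G_form 0 6252565 0 16066804
      + 1724205883809024000 * G_form 0 0 1 0
      + 222464298057433975 * G_form 0 0 0 1"
      by (intro add_nonneg_nonneg mult_nonneg_nonneg G_form_nonneg zero_le_numeral)
  qed simp
  have Z: "0 \<le> 282865220 * (128 * pairs (\<lambda>i j k l m'. z0 i j k l m' * z0 i j k l m'))
      - 683203400 * (64 * pairs (\<lambda>i j k l m'. z0 i j k l m' * z1 i j k l m'))
      + 105101645 * (128 * pairs (\<lambda>i j k l m'. z1 i j k l m' * z1 i j k l m'))"
  proof (rule nonneg_if_multiple)
    show "1285751 * (282865220 * (128 * pairs (\<lambda>i j k l m'. z0 i j k l m' * z0 i j k l m'))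
      - 683203400 * (64 * pairs (\<lambda>i j k l m'. z0 i j k l m' * z1 i j k l m'))
      + 105101645 * (128 * pairs (\<lambda>i j k l m'. z1 i j k l m' * z1 i j k l m'))) =
      7040 * Z_form 2571502 (-1552735)
      + 323880479746560 * Z_form 0 1"
      unfolding Z_form_def power2_eq_square by (simp add: algebra_simps)
    show "0 \<le> 7040 * Z_form 2571502 (-1552735)
      + 323880479746560 * Z_form 0 1"
      by (intro add_nonneg_nonneg mult_nonneg_nonneg Z_form_nonneg zero_le_numeral)
  qed simp
  have S: "0 \<le> 271027814400 * (a * a)
      - 268401025536 * (a * c)
      + 22016655360 * (a * (a * a))
      + 8952480000 * ((2 * b - 17) * (2 * b - 17))
      - 2335973760 * ((2 * b - 17) * (a * a))
      + 66595966400 * (c * c)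
      - 10912393856 * (c * (a * a))
      + 599877440 * ((a * a) * (a * a))"
  proof (rule nonneg_if_multiple)
    show "15649736941779524285175 * (271027814400 * (a * a)
      - 268401025536 * (a * c)
      + 22016655360 * (a * (a * a))
      + 8952480000 * ((2 * b - 17) * (2 * b - 17))
      - 2335973760 * ((2 * b - 17) * (a * a))
      + 66595966400 * (c * c)
      - 10912393856 * (c * (a * a))
      + 599877440 * ((a * a) * (a * a))) =
      1668828465656771132 * (50414400 * a + (-24962893) * c + 2047680 * (a * a))\<^sup>2
      + 14499354155484970224 * (3108500 * (2 * b - 17) + (-405551) * (a * a))\<^sup>2
      + 24868 * (9586780863857 * c + (-353109924720) * (a * a))\<^sup>2
      + 2704539483870768116428007376 * (1 * (a * a))\<^sup>2"
      unfolding power2_eq_square by (simp add: algebra_simps)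
    show "0 \<le> 1668828465656771132 * (50414400 * a + (-24962893) * c + 2047680 * (a * a))\<^sup>2
      + 14499354155484970224 * (3108500 * (2 * b - 17) + (-405551) * (a * a))\<^sup>2
      + 24868 * (9586780863857 * c + (-353109924720) * (a * a))\<^sup>2
      + 2704539483870768116428007376 * (1 * (a * a))\<^sup>2"
      by (intro add_nonneg_nonneg mult_nonneg_nonneg zero_le_power2 zero_le_numeral)
  qed simp
  show ?thesis
    using add_nonneg_nonneg[OF add_nonneg_nonneg[OF W S] add_nonneg_nonneg[OF G Z]]
      ch_trace ch_V rel_aaa rel_aac rel_aaaa
    unfolding g11 g12 g13 g14 g22 g23 g24 g33 g34 g44 z00 z01 z11 by (simp add: algebra_simps)
qed

text \<open>By \<open>pair_sums\<close>, this is the bound 2286/8 for the fourth potential.\<close>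

lemma cert_quartic: "1103 \<le> 134 * a + 96 * b + 62 * e3 + 20 * e4"
proof -
  have W: "0 \<le> 3122938234080 * (5 * a - c)
      + 180637102080 * (c - d1)
      - 606913949952 * (a * a - s3)
      - 1776362548608 * (b * a - c2)
      + 54635264640 * (5 * (a * a) - a * c)
      - 1195262956800 * (5 * c - c2)
      + 160193376000 * (t3 - mm)
      - 225999797760 * (c2 - mr2)
      + 100879447680 * (a * c - a * d1)
      - 302589527040 * (c2 - my)
      + 101345618880 * (c * a - s4)
      + 146392755840 * (a * d1 - r2y)
      - 71790364800 * (a * a * a - a * s3)
      + 266976335232 * (c * a - r2y)
      + 263107025280 * (t3 * a - v3)
      + 253439933184 * (c * b - v3)
      + 15979337136 * (5 * (a * a * a) - a * a * c)
      - 92779784640 * (5 * (a * c) - a * c2)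
      + 303131520000 * (5 * c2 - v3)"
  proof (rule nonneg_if_multiple)
    show "1031205122978341300220464791954359737292783208704045200763765027900686623781407417357310695915 * (3122938234080 * (5 * a - c)
      + 180637102080 * (c - d1)
      - 606913949952 * (a * a - s3)
      - 1776362548608 * (b * a - c2)
      + 54635264640 * (5 * (a * a) - a * c)
      - 1195262956800 * (5 * c - c2)
      + 160193376000 * (t3 - mm)
      - 225999797760 * (c2 - mr2)
      + 100879447680 * (a * c - a * d1)
      - 302589527040 * (c2 - my)
      + 101345618880 * (c * a - s4)
      + 146392755840 * (a * d1 - r2y)
      - 71790364800 * (a * a * a - a * s3)
      + 266976335232 * (c * a - r2y)
      + 263107025280 * (t3 * a - v3)
      + 253439933184 * (c * b - v3)
      + 15979337136 * (5 * (a * a * a) - a * a * c)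
      - 92779784640 * (5 * (a * c) - a * c2)
      + 303131520000 * (5 * c2 - v3)) =
      27388398780007529570335277190831431562263199067089608409713606203015753537533396039072 * W_form 10843535535 313606080 (-1053670052) (-3083962758) 94852890 (-2075109300)
      + 37391134420527906027993083088853637973406733425334815835503090204840912 * W_form 0 65923538517927540 (-43601561210872116) 10746105237804096 20770754716353015 (-56062857996254360)
      + 839050796070035374900315576073595920470271781511988846064490589760 * W_form 0 0 1896183195797265383 2515377343230760461 (-260964017685368712) (-8567259842023357321)
      + 81474590971667255801633244630775249514095895086080960 * W_form 0 0 0 3844723064261411365261803 691547159401157521292886 (-12742008736501171686605993)
      + 1487490393747067694323278213315267763588240 * W_form 0 0 0 0 51929999324486592780135912066 (-826373010911892420907301878741)
      + 1303683313076790810254563724369848616990484035238233591620317067378273015903961373622213709537127090160 * W_form 0 0 0 0 0 1"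
      unfolding W_form_def power2_eq_square by (simp add: algebra_simps)
    show "0 \<le> 27388398780007529570335277190831431562263199067089608409713606203015753537533396039072 * W_form 10843535535 313606080 (-1053670052) (-3083962758) 94852890 (-2075109300)
      + 37391134420527906027993083088853637973406733425334815835503090204840912 * W_form 0 65923538517927540 (-43601561210872116) 10746105237804096 20770754716353015 (-56062857996254360)
      + 839050796070035374900315576073595920470271781511988846064490589760 * W_form 0 0 1896183195797265383 2515377343230760461 (-260964017685368712) (-8567259842023357321)
      + 81474590971667255801633244630775249514095895086080960 * W_form 0 0 0 3844723064261411365261803 691547159401157521292886 (-12742008736501171686605993)
      + 1487490393747067694323278213315267763588240 * W_form 0 0 0 0 51929999324486592780135912066 (-826373010911892420907301878741)
      + 1303683313076790810254563724369848616990484035238233591620317067378273015903961373622213709537127090160 * W_form 0 0 0 0 0 1"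
      by (intro add_nonneg_nonneg mult_nonneg_nonneg W_form_nonneg zero_le_numeral)
  qed simp
  have G: "0 \<le> 1948152520 * edge_form g1 g1
      - 75877478 * (8 * edge_form g1 g2)
      + 306734175 * (16 * edge_form g1 g3)
      - 4230072720 * (2 * edge_form g1 g4)
      + 164775832 * edge_form g2 g2
      - 709571952 * (4 * edge_form g2 g3)
      + 2076342624 * edge_form g2 g4
      + 3320596620 * (4 * edge_form g3 g3)
      - 4176117000 * (4 * edge_form g3 g4)
      + 666827910 * (16 * edge_form g4 g4)"
  proof (rule nonneg_if_multiple)
    show "6180229063152469168139475737115709271748205 * (1948152520 * edge_form g1 g1
      - 75877478 * (8 * edge_form g1 g2)
      + 306734175 * (16 * edge_form g1 g3)
      - 4230072720 * (2 * edge_form g1 g4)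
      + 164775832 * edge_form g2 g2
      - 709571952 * (4 * edge_form g2 g3)
      + 2076342624 * edge_form g2 g4
      + 3320596620 * (4 * edge_form g3 g3)
      - 4176117000 * (4 * edge_form g3 g4)
      + 666827910 * (16 * edge_form g4 g4)) =
      203030643638598700044761611978617256 * G_form 243519065 (-37938739) 306734175 (-528759090)
      + 4598322350828735227124 * G_form 0 397378794554946 (-3506829640845655) 1282373365735600
      + 4870381300 * G_form 0 0 1149580587707183806781 355332030789796040680
      + 997032260885267400262661833932573809215442026171200 * G_form 0 0 0 1"
      unfolding G_form_def power2_eq_square by (simp add: algebra_simps)
    show "0 \<le> 203030643638598700044761611978617256 * G_form 243519065 (-37938739) 306734175 (-528759090)
      + 4598322350828735227124 * G_form 0 397378794554946 (-3506829640845655) 1282373365735600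
      + 4870381300 * G_form 0 0 1149580587707183806781 355332030789796040680
      + 997032260885267400262661833932573809215442026171200 * G_form 0 0 0 1"
      by (intro add_nonneg_nonneg mult_nonneg_nonneg G_form_nonneg zero_le_numeral)
  qed simp
  have Z: "0 \<le> 142364250 * (128 * pairs (\<lambda>i j k l m'. z0 i j k l m' * z0 i j k l m'))
      - 361282680 * (64 * pairs (\<lambda>i j k l m'. z0 i j k l m' * z1 i j k l m'))
      + 60269805 * (128 * pairs (\<lambda>i j k l m'. z1 i j k l m' * z1 i j k l m'))"
  proof (rule nonneg_if_multiple)
    show "105455 * (142364250 * (128 * pairs (\<lambda>i j k l m'. z0 i j k l m' * z0 i j k l m'))
      - 361282680 * (64 * pairs (\<lambda>i j k l m'. z0 i j k l m' * z1 i j k l m'))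
      + 60269805 * (128 * pairs (\<lambda>i j k l m'. z1 i j k l m' * z1 i j k l m'))) =
      6912 * Z_form 527275 (-334521)
      + 40053774907008 * Z_form 0 1"
      unfolding Z_form_def power2_eq_square by (simp add: algebra_simps)
    show "0 \<le> 6912 * Z_form 527275 (-334521)
      + 40053774907008 * Z_form 0 1"
      by (intro add_nonneg_nonneg mult_nonneg_nonneg Z_form_nonneg zero_le_numeral)
  qed simp
  have S: "0 \<le> 299916506160 * (a * a)
      - 245360472624 * (a * c)
      + 14731009920 * (a * (a * a))
      + 7497586800 * ((2 * b - 17) * (2 * b - 17))
      + 10255766400 * ((2 * b - 17) * c)
      - 4009072320 * ((2 * b - 17) * (a * a))
      + 53878765104 * (c * c)
      - 8904560544 * (c * (a * a))
      + 745873920 * ((a * a) * (a * a))"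
  proof (rule nonneg_if_multiple)
    show "850593512451154283841001961465 * (299916506160 * (a * a)
      - 245360472624 * (a * c)
      + 14731009920 * (a * (a * a))
      + 7497586800 * ((2 * b - 17) * (2 * b - 17))
      + 10255766400 * ((2 * b - 17) * c)
      - 4009072320 * ((2 * b - 17) * (a * a))
      + 53878765104 * (c * c)
      - 8904560544 * (c * (a * a))
      + 745873920 * ((a * a) * (a * a))) =
      14702347746723910447116 * (4165507030 * a + (-1703892171) * c + 102298680 * (a * a))\<^sup>2
      + 6848397209180820965169265864913520 * (965 * (2 * b - 17) + 660 * c + (-258) * (a * a))\<^sup>2
      + 36 * (2116054655544604267 * c + (-764386219961239700) * (a * a))\<^sup>2
      + 3684136885531319253272372011962789120 * (1 * (a * a))\<^sup>2"
      unfolding power2_eq_square by (simp add: algebra_simps)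
    show "0 \<le> 14702347746723910447116 * (4165507030 * a + (-1703892171) * c
          + 102298680 * (a * a))\<^sup>2
      + 6848397209180820965169265864913520 * (965 * (2 * b - 17) + 660 * c + (-258) * (a * a))\<^sup>2
      + 36 * (2116054655544604267 * c + (-764386219961239700) * (a * a))\<^sup>2
      + 3684136885531319253272372011962789120 * (1 * (a * a))\<^sup>2"
      by (intro add_nonneg_nonneg mult_nonneg_nonneg zero_le_power2 zero_le_numeral)
  qed simp
  show ?thesis
    using add_nonneg_nonneg[OF add_nonneg_nonneg[OF W S] add_nonneg_nonneg[OF G Z]]
      ch_trace ch_V rel_aaa rel_aac rel_aaaa
    unfolding g11 g12 g13 g14 g22 g23 g24 g33 g34 g44 z00 z01 z11 by (simp add: algebra_simps)
qed

subsection \<open>Bounding the energy\<close>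

lemma pair_sum_cong:
  assumes "\<And>i j. i \<in> {1..5} \<Longrightarrow> j \<in> {1..5} \<Longrightarrow> j < i \<Longrightarrow> f (1 + u i j) = g (1 + u i j)"
  shows "pair_sum f = pair_sum g"
  unfolding pair_sum_def using assms by (intro sum.cong) auto

text \<open>The bounds are the values at the bi-pyramid, where \<open>w\<close> is 1 six times, 1/2
  three times and 0 once.\<close>

lemma pair_sum_bounds:
  "15 / 2 \<le> pair_sum (\<lambda>w. w)"
  "51 / 8 \<le> pair_sum (\<lambda>w. w ^ 3)"
  "159 / 8 \<le> pair_sum (\<lambda>w. 2 * w\<^sup>2 + w ^ 3)"
  "2286 / 8 \<le> pair_sum (\<lambda>w. 24 * w + 15 * w\<^sup>2 - 9 * w ^ 3 + 10 * w ^ 4)"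
proof -
  have "0 \<le> a"
    unfolding V_V[symmetric] by simp
  then show "15 / 2 \<le> pair_sum (\<lambda>w. w)"
    by (simp add: pair_sums)
  show "51 / 8 \<le> pair_sum (\<lambda>w. w ^ 3)"
    using cert_cubic by (simp add: pair_sums)
  show "159 / 8 \<le> pair_sum (\<lambda>w. 2 * w\<^sup>2 + w ^ 3)"
    unfolding pair_sum_linear(1-3) pair_sums using cert_quadratic_cubic by (simp add: field_simps)
  show "2286 / 8 \<le> pair_sum (\<lambda>w. 24 * w + 15 * w\<^sup>2 - 9 * w ^ 3 + 10 * w ^ 4)"
    unfolding pair_sum_linear(1-3) pair_sums using cert_quartic by (simp add: field_simps)
qed

lemma bipyramid_if_extremal:
  assumes vals: "\<And>i j. i \<in> {1..5} \<Longrightarrow> j \<in> {1..5} \<Longrightarrow> i \<noteq> j \<Longrightarrow> 1 + u i j \<in> {0, 1 / 2, 1}"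
    and s1: "pair_sum (\<lambda>w. w) = 15 / 2" and s3: "pair_sum (\<lambda>w. w ^ 3) = 51 / 8"
  shows "triangular_bipyramid (p ` {1..5})"
proof -
  have "\<exists>i\<in>{1..5}. \<exists>j\<in>{1..5}. i \<noteq> j \<and> u i j = - 1"
  proof (rule ccontr)
    assume no: "\<not> ?thesis"
    \<comment> \<open>Without an antipodal pair only 1/2 and 1 occur, where the cube agrees with its
      chord. The chord would give the sum 45/8 instead of 51/8.\<close>
    have "pair_sum (\<lambda>w. w ^ 3) = pair_sum (\<lambda>w. 7 / 4 * w - 3 / 4)"
    proof (rule pair_sum_cong)
      fix i j :: nat assume ij: "i \<in> {1..5}" "j \<in> {1..5}" "j < i"
      then have "i \<noteq> j"
        by simp
      then have "1 + u i j \<in> {0, 1 / 2, 1}" "u i j \<noteq> - 1"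
        using vals[OF ij(1,2)] no ij(1,2) by blast+
      then have "1 + u i j = 1 / 2 \<or> 1 + u i j = 1"
        by auto
      then show "(1 + u i j) ^ 3 = 7 / 4 * (1 + u i j) - 3 / 4"
        by (elim disjE; simp only:; simp add: power3_eq_cube)
    qed
    then show False
      using s1 s3 unfolding pair_sum_linear(2-4) by simp
  qed
  then obtain i j where ij: "i \<in> {1..5}" "j \<in> {1..5}" "i \<noteq> j" and u_ij: "u i j = - 1"
    by blast
  have "card ({1..5} - {i, j}) = 3"
    using ij by (simp add: card_Diff_subset)
  then obtain k l m where klm: "{1..5}
        - {i, j} = {k, l, m}" and distinct: "k \<noteq> l" "k \<noteq> m" "l \<noteq> m"
    by (elim iffD1[OF card_3_iff, elim_format] exE conjE)
  have "{1..5} = {i, j} \<union> ({1..5} - {i, j})"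
    using ij by blast
  then have I: "{1..5} = {i, j, k, l, m}"
    unfolding klm by (simp only: Un_insert_left Un_empty_left)
  have mem: "k \<in> {1..5}" "l \<in> {1..5}" "m \<in> {1..5}"
    unfolding I by simp_all
  have neq: "i \<notin> {j, k, l, m}" "j \<notin> {k, l, m}" "k \<notin> {l, m}" "l \<notin> {m}"
  proof -
    have "i \<notin> {k, l, m}" "j \<notin> {k, l, m}"
      unfolding klm[symmetric] by simp_all
    then show "i \<notin> {j, k, l, m}" "j \<notin> {k, l, m}" "k \<notin> {l, m}" "l \<notin> {m}"
      using distinct ij(3) by simp_all
  qed
  have "(p i + p j) \<bullet> (p i + p j) = 0"
    using u_ij ij unfolding u_def by (simp add: inner_add_left inner_add_right inner_commute[of "p j" "p i"] unit)
  then have "p i + p j = 0"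
    by (simp only: inner_eq_zero_iff)
  then have pj: "p j = - p i"
    by (simp add: add_eq_0_iff)
  have sym: "u s t = u t s" for s t
    by (simp add: u_def inner_commute)
  have zero: "u i t = 0" "u j t = 0" "u t i = 0" "u t j = 0" if "t \<in> {k, l, m}" for t
  proof -
    have t: "t \<in> {1..5}" "i \<noteq> t" "j \<noteq> t"
      using that mem neq by auto
    \<comment> \<open>Both inner products are at most 0 by \<open>vals\<close> and they are
      opposite, hence zero.\<close>
    have "u j t = - u i t"
      by (simp add: u_def pj)
    then show "u i t = 0" "u j t = 0" "u t i = 0" "u t j = 0"
      using vals[OF ij(1) t(1,2)] vals[OF ij(2) t(1,3)] by (auto simp: sym[of t])
  qed
  have diag: "u t t = 1" if "t \<in> {1..5}" for t
    using that by (simp add: u_def unit)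
  have sum_I: "(\<Sum>t\<in>{1..5}. f t) = f i + (f j + (f k + (f l
        + f m)))" for f :: "nat \<Rightarrow> real"
    unfolding I using neq by simp
  define wkl and wkm and wlm where w: "wkl = 1 + u k l" "wkm = 1 + u k m" "wlm = 1 + u l m"
  have us: "u k l = wkl - 1" "u k m = wkm - 1" "u l m = wlm - 1" "u l k = wkl - 1" "u m k = wkm
        - 1" "u m l = wlm - 1"
    by (simp_all add: w sym[of l k] sym[of m k] sym[of m l])
  have zeros: "u i k = 0" "u i l = 0" "u i m = 0" "u j k = 0" "u j l = 0" "u j m = 0"
    "u k i = 0" "u l i = 0" "u m i = 0" "u k j = 0" "u l j = 0" "u m j = 0"
    by (simp_all add: zero)
  have us': "u i j = - 1" "u j i = - 1" "u i i = 1" "u j j = 1" "u k k = 1" "u l l = 1" "u m m = 1"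
    using u_ij sym[of j i] diag ij mem by simp_all
  \<comment> \<open>The antipodal pair contributes 0 and each of the six mixed pairs contributes 1,
    which leaves 15/2 - 6 and 51/8 - 6.\<close>
  have w1: "wkl + wkm + wlm = 3 / 2"
    using s1 unfolding pair_sum_eq sum_I us zeros us' by simp
  have w3: "wkl ^ 3 + wkm ^ 3 + wlm ^ 3 = 3 / 8"
    using s3 unfolding pair_sum_eq sum_I us zeros us' by simp
  have range: "wkl \<in> {0, 1 / 2, 1}" "wkm \<in> {0, 1 / 2, 1}" "wlm \<in> {0, 1 / 2, 1}"
    unfolding w using vals[OF mem(1,2)] vals[OF mem(1,3)] vals[OF mem(2,3)] distinct by simp_all
  \<comment> \<open>The line \<open>3 / 4 * w - 1 / 4\<close> is tangent to the cube at \<open>1 / 2\<close>.\<close>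
  have "w = 1 / 2 \<or> 1 / 4 \<le> w ^ 3 - (3 / 4 * w - 1 / 4)" if "w \<in> {0, 1 / 2, 1}" for w :: real
    using that by (elim insertE emptyE; hypsubst; simp add: power3_eq_cube)
  moreover have "0 \<le> w ^ 3 - (3 / 4 * w - 1 / 4)" if "w \<in> {0, 1 / 2, 1}" for w :: real
    using that by (elim insertE emptyE; hypsubst; simp add: power3_eq_cube)
  ultimately have cube: "w = 1 / 2 \<or> 1 / 4 \<le> w ^ 3 - (3 / 4 * w - 1 / 4)" "0 \<le> w ^ 3
        - (3 / 4 * w - 1 / 4)"
    if "w \<in> {0, 1 / 2, 1}" for w :: real
    using that by blast+
  \<comment> \<open>By \<open>w1\<close> and \<open>w3\<close> the three gaps between cube and
    tangent sum to zero, so none can be 1/4 or more.\<close>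
  have "wkl = 1 / 2" "wkm = 1 / 2" "wlm = 1 / 2"
    using w1 w3 cube(1)[OF range(1)] cube(1)[OF range(2)] cube(1)[OF range(3)]
      cube(2)[OF range(1)] cube(2)[OF range(2)] cube(2)[OF range(3)] by linarith+
  then have half: "u k l = - 1 / 2" "u l m = - 1 / 2" "u m k = - 1 / 2"
    using us by simp_all
  have S: "p t \<in> S2" if "t \<in> {1..5}" for t
    using unit[OF that] by (simp add: norm_eq_1)
  have d: "(dist (p k) (p l))\<^sup>2 = 3" "(dist (p l) (p m))\<^sup>2 = 3" "(dist (p m) (p k))\<^sup>2 = 3"
    using dist_sphere S mem half unfolding u_def by simp_all
  then have "dist (p k) (p l) = sqrt 3" "dist (p l) (p m) = sqrt 3" "dist (p m) (p k) = sqrt 3"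
    by (metis real_sqrt_unique zero_le_dist)+
  moreover have "p ` {1..5} = {p i, - p i, p k, p l, p m}"
    unfolding I by (simp add: pj)
  moreover have "p k \<bullet> p i = 0" "p l \<bullet> p i = 0" "p m \<bullet> p i = 0"
    using zeros unfolding u_def by simp_all
  moreover have "p k \<noteq> p l"
    using d(1) by auto
  ultimately show ?thesis
    unfolding triangular_bipyramid_def using S ij mem
    by (intro exI[of _ "p i"] exI[of _ "p k"] exI[of _ "p l"] exI[of _ "p m"]) simp
qed

text \<open>The interpolation bound holds for each pair. Equality of the sums forces equality in
  every term, so that only the interpolation distances occur.\<close>

lemma energy_ge_pair_sum:
  assumes inj: "inj_on p {1..5}"
  shows "pair_sum \<Gamma> \<le> coulomb_energy p"
    and "coulomb_energy p \<le> pair_sum \<Gamma> \<Longrightarrow> i \<in> {1..5} \<Longrightarrow> j \<in> {1..5} \<Longrightarrow> i \<noteq> j \<Longrightarrow> 1 + u i j \<in> {0, 1 / 2, 1}"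
proof -
  let ?S = "{(i, j). i \<in> {1..5::nat} \<and> j \<in> {1..5} \<and> i > j}"
  have d: "1 + u i j = (4 - (norm (p i - p j))\<^sup>2) / 2" "0 < norm (p i - p j)" "norm (p i
        - p j) \<le> 2"
    if "i \<in> {1..5}" "j \<in> {1..5}" "i \<noteq> j" for i j
  proof -
    have S: "p i \<in> S2" "p j \<in> S2"
      using unit that by (simp_all add: norm_eq_1)
    then show "1 + u i j = (4 - (norm (p i - p j))\<^sup>2) / 2"
      using dist_sphere[of "p i" "p j"] by (simp add: u_def dist_norm)
    show "0 < norm (p i - p j)"
      using inj that by (auto dest: inj_onD)
    show "norm (p i - p j) \<le> 2"
      using norm_triangle_ineq4[of "p i" "p j"] S by simp
  qed
  have le: "\<Gamma> (1 + u i j) \<le> 1 / norm (p i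
        - p j)" if "i \<in> {1..5}" "j \<in> {1..5}" "i \<noteq> j" for i j
    unfolding d(1)[OF that] by (rule gamma_le(1)[OF d(2,3)[OF that]])
  show ge: "pair_sum \<Gamma> \<le> coulomb_energy p"
    unfolding pair_sum_def coulomb_energy_def by (intro sum_mono) (auto intro!: le)
  assume "coulomb_energy p \<le> pair_sum \<Gamma>"
  with ge have eq: "coulomb_energy p = pair_sum \<Gamma>"
    by simp
  have fin: "finite ?S"
    by (rule finite_subset[of _ "{1..5} \<times> {1..5}"]) auto
  have "(\<Sum>(i, j)\<in>?S. 1 / norm (p i - p j) - \<Gamma> (1 + u i j)) = 0"
    using eq unfolding pair_sum_def coulomb_energy_def by (simp add: sum_subtractf case_prod_unfold)
  then have "\<forall>(i, j)\<in>?S. 1 / norm (p i - p j) - \<Gamma> (1 + u i j) = 0"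
    by (subst (asm) sum_nonneg_eq_0_iff[OF fin]) (auto simp: le)
  then have lt: "1 + u i j \<in> {0, 1 / 2, 1}" if "i \<in> {1..5}" "j \<in> {1..5}" "j < i" for i j
  proof -
    have ij: "i \<noteq> j"
      using that by simp
    have "\<Gamma> ((4 - (norm (p i - p j))\<^sup>2) / 2) = 1 / norm (p i - p j)"
      unfolding d(1)[OF that(1,2) ij, symmetric] using \<open>\<forall>(i, j)\<in>?S. _\<close> that by auto
    then have "norm (p i - p j) \<in> {sqrt 2, sqrt 3, 2}"
      by (rule gamma_le(2)[OF d(2,3)[OF that(1,2) ij]])
    then show ?thesis
      unfolding d(1)[OF that(1,2) ij] by auto
  qed
  have sym: "u i j = u j i"
    by (simp add: u_def inner_commute)
  assume "i \<in> {1..5}" "j \<in> {1..5}" "i \<noteq> j"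
  then show "1 + u i j \<in> {0, 1 / 2, 1}"
    using lt[of i j] lt[of j i] sym by (cases "j < i") auto
qed

lemma energy_bound:
  assumes inj: "inj_on p {1..5}"
  shows "6 / sqrt 2 + 3 / sqrt 3 + 1 / 2 \<le> coulomb_energy p"
    and "coulomb_energy p \<le> 6 / sqrt 2 + 3 / sqrt 3
          + 1 / 2 \<Longrightarrow> triangular_bipyramid (p ` {1..5})"
proof -
  obtain k0 k1 k2 k3 k4 where pos: "0 < k1" "0 < k2" "0 < k3" "0 < k4"
    and dec: "\<And>w. \<Gamma> w = k0 + k1 * w + k2 * w ^ 3 + k3 * (2 * w\<^sup>2 + w ^ 3)
      + k4 * (24 * w + 15 * w\<^sup>2 - 9 * w ^ 3 + 10 * w ^ 4)"
    using gamma_decomposition by metis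
  define s1 and s3 and sC and sA where s: "s1 = pair_sum (\<lambda>w. w)" "s3 = pair_sum (\<lambda>w. w ^ 3)"
    "sC = pair_sum (\<lambda>w. 2 * w\<^sup>2 + w ^ 3)" "sA = pair_sum (\<lambda>w. 24 * w
          + 15 * w\<^sup>2 - 9 * w ^ 3 + 10 * w ^ 4)"
  have sum: "pair_sum \<Gamma> = 10 * k0 + k1 * s1 + k2 * s3 + k3 * sC + k4 * sA"
    unfolding dec[abs_def] s pair_sum_linear(1,3,4) by simp
  have val: "\<Gamma> 0 = 1 / 2" "\<Gamma> (1 / 2) = 1 / sqrt 3" "\<Gamma> 1 = 1 / sqrt 2"
    by (simp_all add: \<Gamma>_def field_simps power2_eq_square power3_eq_cube power4_eq_xxxx)
  \<comment> \<open>The interpolant agrees with the potential at the three distances of the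
    bi-pyramid, so the minimal energy is the same combination of the four lower bounds.\<close>
  have "6 / sqrt 2 + 3 / sqrt 3 + 1 / 2 = 6 * \<Gamma> 1 + 3 * \<Gamma> (1 / 2) + \<Gamma> 0"
    unfolding val by simp
  also have "\<dots> = 10 * k0 + k1 * (15 / 2) + k2 * (51 / 8) + k3 * (159 / 8) + k4 * (2286 / 8)"
    unfolding dec by (simp add: field_simps power2_eq_square power3_eq_cube power4_eq_xxxx)
  finally have E: "6 / sqrt 2 + 3 / sqrt 3 + 1 / 2 =
    10 * k0 + k1 * (15 / 2) + k2 * (51 / 8) + k3 * (159 / 8) + k4 * (2286 / 8)" .
  note bounds = pair_sum_bounds[folded s]
  have prods: "k1 * (15 / 2) \<le> k1 * s1" "k2 * (51 / 8) \<le> k2 * s3" "k3 * (159 / 8) \<le> k3 * sC" "k4 * (2286 / 8) \<le> k4 * sA"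
    using bounds pos by (intro mult_left_mono; simp)+
  then show "6 / sqrt 2 + 3 / sqrt 3 + 1 / 2 \<le> coulomb_energy p"
    using energy_ge_pair_sum(1)[OF inj] unfolding E sum by linarith
  assume le: "coulomb_energy p \<le> 6 / sqrt 2 + 3 / sqrt 3 + 1 / 2"
  \<comment> \<open>No slack is left in any of the four bounds; the first two are the moments that
    \<open>bipyramid_if_extremal\<close> asks for.\<close>
  have "k1 * (15 / 2) = k1 * s1" "k2 * (51 / 8) = k2 * s3"
    using energy_ge_pair_sum(1)[OF inj] le prods unfolding E sum by linarith+
  then have "s1 = 15 / 2" "s3 = 51 / 8"
    using pos by simp_all
  moreover have "coulomb_energy p \<le> pair_sum \<Gamma>"
    using le prods unfolding E sum by linarith
  ultimately show "triangular_bipyramid (p ` {1..5})"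
    using bipyramid_if_extremal energy_ge_pair_sum(2)[OF inj] unfolding s by blast
qed

end

section \<open>Minimality and uniqueness of the bi-pyramid\<close>

lemma energy_lower_bound:
  assumes "configuration q"
  shows "6 / sqrt 2 + 3 / sqrt 3 + 1 / 2 \<le> coulomb_energy q"
    and "coulomb_energy q \<le> 6 / sqrt 2 + 3 / sqrt 3
          + 1 / 2 \<Longrightarrow> triangular_bipyramid (q ` {1..5})"
proof -
  interpret five_points q
  proof
    fix i :: nat assume "i \<in> {1..5}"
    then have "q i \<in> S2"
      using assms unfolding configuration_def by blast
    then show "q i \<bullet> q i = 1"
      by (simp add: norm_eq_1)
  qed
  show "6 / sqrt 2 + 3 / sqrt 3 + 1 / 2 \<le> coulomb_energy q"
    and "coulomb_energy q \<le> 6 / sqrt 2 + 3 / sqrt 3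
          + 1 / 2 \<Longrightarrow> triangular_bipyramid (q ` {1..5})"
    using energy_bound assms by (simp_all add: configuration_def)
qed

lemma triangular_bipyramid_exists: "\<exists>p. triangular_bipyramid (p ` {1..5::nat})"
proof -
  define n x y :: "real^3" where "n = vector [0, 0, 1]" and "x = vector [1, 0, 0]"
    and "y = vector [- 1 / 2, sqrt 3 / 2, 0]"
  have "bipyramid_frame n x y"
    by (simp add: bipyramid_frame_def n_def x_def y_def inner_vec_def sum_3)
  then have T: "triangular_bipyramid {n, - n, x, y, - x - y}"
    unfolding triangular_bipyramid_iff_frame by blast
  define p :: "nat \<Rightarrow> real^3" where
    "p i = (if i = 1 then n else if i = 2 then - n else if i = 3 then x else if i = 4 then y else - x
          - y)" for i
  have I: "{1..5::nat} = {1, 2, 3, 4, 5}"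
    by auto
  have "p 1 = n" "p 2 = - n" "p 3 = x" "p 4 = y" "p 5 = - x - y"
    by (simp_all add: p_def)
  then have "p ` {1..5} = {n, - n, x, y, - x - y}"
    unfolding I image_insert image_empty by simp
  then show ?thesis
    using T by metis
qed

theorem theorem1p1:
  shows "(\<exists>p. triangular_bipyramid (p ` {1..5::nat})) \<and>
    (\<forall>p. triangular_bipyramid (p ` {1..5::nat}) \<longrightarrow>
       minimal_energy p \<and>
       (\<forall>q. minimal_energy q \<longrightarrow>
          (\<exists>f. sphere_isometry f \<and> q ` {1..5} = f ` p ` {1..5})))"
proof (intro conjI allI impI)
  show "\<exists>p. triangular_bipyramid (p ` {1..5::nat})"
    by (rule triangular_bipyramid_exists)
next
  fix p :: "nat \<Rightarrow> real^3"
  assume p: "triangular_bipyramid (p ` {1..5})"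
  note energy_p = triangular_bipyramid_energy[OF p]
  show "minimal_energy p"
    unfolding minimal_energy_def energy_p(2)
    using energy_p(1) energy_lower_bound(1) by blast
  fix q assume q: "minimal_energy q"
  then have "configuration q" "coulomb_energy q \<le> coulomb_energy p"
    using energy_p(1) by (simp_all add: minimal_energy_def)
  then have "triangular_bipyramid (q ` {1..5})"
    using energy_lower_bound(2) energy_p(2) by simp
  then show "\<exists>f. sphere_isometry f \<and> q ` {1..5} = f ` p ` {1..5}"
    using triangular_bipyramids_isometric p by blast
qed

end
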